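(* Let $n$ be a positive odd integer. Then \begin{align*} \sum_{k=0}^{n-1} (-1)^k [3k+1]\frac{(q;q^2)_k^3}{(q;q)_k^3} &\equiv (-1)^{(n-1)/2}q^{(1-n^2)/4} \left(q^{\binom{n}{2}}[n]+\frac{(n^2-1)(1-q)^2}{24}[n]^3\right) \\ &\quad+[n]^3\sum_{k=1}^{(n-1)/2}\frac{q^k (q^2;q^2)_{k}}{[2k][2k-1](q;q^2)_{k}} \pmod{[n]\Phi_n(q)^3}. \end{align*}
   Context: Here $q$ is an indeterminate. The $q$-integer is $[m]=1+q+\cdots+q^{m-1}$. The $q$-shifted factorial is $(a;q)_0=1$ and $(a;q)_m=(1-a)(1-aq)\cdots(1-aq^{m-1})$ for $m\geq 1$. $\Phi_n(q)$ denotes the $n$-th cyclotomic polynomial, $\Phi_n(q)=\prod_{1\le k\le n,\ \gcd(k,n)=1}(q-\zeta^k)$ with $\zeta$ a primitive $n$-th root of unity. For rational functions $A(q),B(q)$ and a polynomial $P(q)\in\mathbb{Z}[q]$, $A(q)\equiv B(q)\pmod{P(q)}$ means that $P(q)$ divides the numerator of the reduced form of $A(q)-B(q)$ in $\mathbb{Z}[q]$. An empty sum equals $0$. *)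

theory Defs
  imports Complex_Main "HOL-Computational_Algebra.Computational_Algebra"
begin

section \<open>\<open>q\<close>-integers and \<open>q\<close>-shifted factorials\<close>

definition qint :: "'a::comm_ring_1 \<Rightarrow> nat \<Rightarrow> 'a" where
  "qint q m = (\<Sum>i<m. q ^ i)"

text \<open>\<open>qshifted a q m\<close> is $(a;q)_m$.\<close>

definition qshifted :: "'a::comm_ring_1 \<Rightarrow> 'a \<Rightarrow> nat \<Rightarrow> 'a" where
  "qshifted a q m = (\<Prod>i<m. 1 - a * q ^ i)"


section \<open>Congruences between rational functions\<close>

text \<open>
  Rational functions in the indeterminate are elements of the fraction field of
  $\mathbb{Z}[q]$, which is also the field $\mathbb{Q}(q)$; \<open>qP\<close> is the indeterminate as a
  polynomial and \<open>qR\<close> is its image in this field.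
\<close>

definition qP :: "int poly" where
  "qP = [:0, 1:]"

definition qR :: "int poly fract" where
  "qR = to_fract qP"

text \<open>
  \<open>quot_of_fract\<close> returns the coprime numerator and denominator over the factorial ring
  $\mathbb{Z}[q]$ (integer constants are not units there); the divisibility is
  that of \<open>int poly\<close>.
\<close>

definition rat_cong :: "int poly fract \<Rightarrow> int poly fract \<Rightarrow> int poly \<Rightarrow> bool" where
  "rat_cong A B P \<longleftrightarrow> P dvd fst (quot_of_fract (A - B))"


section \<open>Cyclotomic polynomials\<close>

definition cyclotomic_complex :: "nat \<Rightarrow> complex poly" where
  "cyclotomic_complex n =
     (\<Prod>k\<in>{k. 1 \<le> k \<and> k \<le> n \<and> gcd k n = 1}. [:- (cis (2 * pi / real n) ^ k), 1:])"

text \<open>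
  The product above has integer coefficients; \<open>cyclotomic\<close> is the same polynomial as an element
  of $\mathbb{Z}[q]$. That the description is proper is lemma \<open>cyclotomic_eq\<close> below.
\<close>

definition cyclotomic :: "nat \<Rightarrow> int poly" where
  "cyclotomic n = (THE p. map_poly of_int p = cyclotomic_complex n)"

lemma map_poly_of_int_diff:
  "map_poly of_int (p - q) = (map_poly of_int p - map_poly of_int q :: complex poly)"
  by (rule poly_eqI) (simp add: coeff_map_poly)

lemma map_poly_of_int_mult:
  "map_poly of_int (p * q) = (map_poly of_int p * map_poly of_int q :: complex poly)"
  by (rule poly_eqI) (simp add: coeff_map_poly coeff_mult)

lemma map_poly_of_int_prod:
  "map_poly of_int (prod f A) = (\<Prod>x\<in>A. map_poly of_int (f x) :: complex poly)"
  by (induction A rule: infinite_finite_induct) (auto simp: map_poly_of_int_mult)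

lemma map_poly_of_int_inject:
  "map_poly of_int p = (map_poly of_int q :: complex poly) \<longleftrightarrow> p = q"
proof
  assume eq: "map_poly of_int p = (map_poly of_int q :: complex poly)"
  show "p = q"
  proof (rule poly_eqI)
    fix i
    from eq have "coeff (map_poly of_int p) i = (coeff (map_poly of_int q) i :: complex)"
      by simp
    then show "coeff p i = coeff q i"
      by (simp add: coeff_map_poly)
  qed
qed simp

lemma lead_coeff_map_poly_of_int:
  "lead_coeff (map_poly of_int p :: complex poly) = of_int (lead_coeff p)"
  by (simp add: degree_map_poly coeff_map_poly)

lemma integral_cofactor:
  fixes D P :: "int poly" and F :: "complex poly"
  assumes "lead_coeff D = 1" "map_poly of_int D * F = map_poly of_int P"
  shows "\<exists>G. F = map_poly of_int G"
  using assms(2)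
proof (induction "degree F" arbitrary: F P rule: less_induct)
  case less
  define c where "c = lead_coeff P"
  have "lead_coeff (map_poly of_int D * F) = of_int c"
    unfolding less.prems c_def by (rule lead_coeff_map_poly_of_int)
  then have lF: "lead_coeff F = of_int c"
    unfolding lead_coeff_mult lead_coeff_map_poly_of_int assms(1) by simp
  show ?case
  proof (cases "degree F = 0")
    case True
    then have "F = [:of_int c:]"
      using lF by (metis degree_0_id coeff_pCons_0 degree_eq_zeroE)
    also have "\<dots> = map_poly of_int [:c:]"
      by (simp add: map_poly_pCons)
    finally show ?thesis by blast
  next
    case False
    define M where "M = (monom c (degree F) :: int poly)"
    have M: "map_poly of_int M = (monom (lead_coeff F) (degree F) :: complex poly)"
      unfolding M_def lF by (rule poly_eqI) (simp add: coeff_map_poly)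
    define F' where "F' = F - map_poly of_int M"
    have "degree F' \<le> degree F"
      unfolding F'_def M by (intro degree_diff_le) (auto simp: degree_monom_le)
    moreover have "coeff F' (degree F) = 0"
      unfolding F'_def M by simp
    ultimately have "degree F' < degree F"
      using False by (metis eq_zero_or_degree_less degree_0 gr0I)
    moreover have "map_poly of_int D * F' = map_poly of_int (P - D * M)"
      unfolding F'_def map_poly_of_int_diff map_poly_of_int_mult
      using less.prems by (simp add: algebra_simps)
    ultimately obtain G where "F' = map_poly of_int G"
      using less.hyps by blast
    then have "F = map_poly of_int G + map_poly of_int M"
      by (simp add: F'_def algebra_simps)
    also have "\<dots> = map_poly of_int (G + M)"
      by (rule poly_eqI) (simp add: coeff_map_poly)
    finally show ?thesis by blast
  qed
qed

lemma prod_roots_of_unity: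
  assumes "n > 0"
  shows "(\<Prod>k\<in>{1..n}. [:- cis (2 * pi * real k / real n), 1:]) = monom 1 n - 1"
proof -
  let ?p = "monom 1 n - 1 :: complex poly"
  have poly: "poly ?p z = z ^ n - 1" for z
    by (simp add: poly_monom)
  have lc: "lead_coeff ?p = 1"
  proof -
    have "degree ?p = degree (monom 1 n :: complex poly)"
      unfolding diff_conv_add_uminus
      by (rule degree_add_eq_left) (use assms in \<open>simp add: degree_monom_eq\<close>)
    then show ?thesis
      using assms by (simp add: degree_monom_eq)
  qed
  have "rsquarefree ?p"
    using assms by (auto simp: rsquarefree_roots pderiv_diff pderiv_monom poly_monom power_0_left)
  then have "(\<Prod>z|poly ?p z = 0. [:- z, 1:]) = ?p"
    using complex_poly_decompose_rsquarefree[of ?p] lc by simp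
  then have *: "(\<Prod>z|z ^ n = 1. [:- z, 1:]) = ?p"
    unfolding poly by simp
  have "(\<Prod>z|z ^ n = 1. [:- z, 1:]) = (\<Prod>k<n. [:- cis (2 * pi * real k / real n), 1:])"
    by (rule prod.reindex_bij_betw[OF bij_betw_roots_unity[OF assms], symmetric])
  also have "\<dots> = (\<Prod>k\<in>{1..n}. [:- cis (2 * pi * real k / real n), 1:])"
  proof (rule prod.reindex_bij_witness[of _ "\<lambda>k. if k = n then 0 else k"
            "\<lambda>k. if k = 0 then n else k"])
  qed (use assms in \<open>auto\<close>)
  finally show ?thesis
    using * by simp
qed

lemma prod_cyclotomic_complex:
  assumes "n > 0"
  shows "(\<Prod>d | d dvd n. cyclotomic_complex d) = monom 1 n - 1"
proof -
  let ?h = "\<lambda>k. [:- cis (2 * pi * real k / real n), 1:]"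
  let ?g = "\<lambda>k. n div gcd k n"
  have "(\<Prod>d | d dvd n. cyclotomic_complex d) =
        (\<Prod>d | d dvd n. \<Prod>k\<in>{k \<in> {1..n}. ?g k = d}. ?h k)"
  proof (rule prod.cong[OF refl])
    fix d assume "d \<in> {d. d dvd n}"
    then obtain e where e: "n = d * e" by auto
    with assms have pos: "d > 0" "e > 0" by auto
    have gcd_e: "gcd k n = e" if "n div gcd k n = d" for k
    proof -
      have "gcd k n * d = n"
        using that by (metis dvd_mult_div_cancel gcd_dvd2)
      then show ?thesis
        using e pos by (metis mult.commute mult_cancel1 not_gr0)
    qed
    show "cyclotomic_complex d = (\<Prod>k\<in>{k \<in> {1..n}. ?g k = d}. ?h k)"
      unfolding cyclotomic_complex_def
    proof (rule prod.reindex_bij_witness[of _ "\<lambda>k. k div e" "\<lambda>k. k * e"], goal_cases)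
      case (1 k)
      then show ?case using pos by simp
    next
      case (2 k)
      then have "gcd (k * e) (d * e) = e"
        by (simp only: gcd_mult_distrib_nat[symmetric] mult.commute[of _ e]) simp
      then show ?case
        using 2 pos e by simp
    next
      case (3 k)
      then have "e dvd k" using gcd_e by (metis (mono_tags, lifting) gcd_dvd1 mem_Collect_eq)
      then show ?case by simp
    next
      case (4 k)
      then have g: "gcd k n = e" using gcd_e by simp
      then obtain l where l: "k = l * e" by (metis gcd_dvd1 dvd_def mult.commute)
      have "e * gcd l d = e"
        using g unfolding l e by (simp add: gcd_mult_distrib_nat mult.commute)
      then have "gcd l d = 1" using pos by simp
      then show ?case using 4 l pos e by simp
    next
      case (5 k)
      have "cis (2 * pi / real d) ^ k = cis (2 * pi * real (k * e) / real n)"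
        unfolding Complex.DeMoivre e using pos by (simp add: field_simps)
      then show ?case by simp
    qed
  qed
  also have "\<dots> = (\<Prod>k\<in>{1..n}. ?h k)"
    by (rule prod.group)
       (use assms in \<open>auto intro: finite_divisors_nat simp: div_dvd_iff_mult\<close>)
  also have "\<dots> = monom 1 n - 1"
    by (rule prod_roots_of_unity[OF assms])
  finally show ?thesis .
qed

lemma lead_coeff_cyclotomic_complex: "lead_coeff (cyclotomic_complex n) = 1"
  unfolding cyclotomic_complex_def lead_coeff_prod by simp

lemma cyclotomic_complex_integral: "\<exists>p. map_poly of_int p = cyclotomic_complex n"
proof (induction n rule: less_induct)
  case (less n)
  show ?case
  proof (cases "n = 0")
    case True
    then have "{k. 1 \<le> k \<and> k \<le> n \<and> gcd k n = 1} = {}" by auto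
    then have "cyclotomic_complex n = map_poly of_int 1"
      unfolding cyclotomic_complex_def by (simp only: prod.empty map_poly_1' of_int_1)
    then show ?thesis by metis
  next
    case False
    let ?A = "{d. d dvd n \<and> d \<noteq> n}"
    have "\<forall>d\<in>?A. \<exists>p. map_poly of_int p = cyclotomic_complex d"
      using False less by (auto dest: dvd_imp_le)
    then obtain f where f: "\<And>d. d \<in> ?A \<Longrightarrow> map_poly of_int (f d) = cyclotomic_complex d"
      by metis
    define D where "D = prod f ?A"
    have D: "map_poly of_int D = prod cyclotomic_complex ?A"
      unfolding D_def map_poly_of_int_prod by (intro prod.cong refl f)
    have "complex_of_int (lead_coeff D) = 1"
      unfolding lead_coeff_map_poly_of_int[symmetric] D lead_coeff_prod
      by (simp add: lead_coeff_cyclotomic_complex)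
    then have lD: "lead_coeff D = 1" by simp
    have "{d. d dvd n} = insert n ?A" by auto
    moreover have "finite ?A"
      using False by (auto intro: finite_subset[OF _ finite_divisors_nat[of n]])
    ultimately have "map_poly of_int D * cyclotomic_complex n = monom 1 n - 1"
      using prod_cyclotomic_complex[of n] False unfolding D by (simp add: mult.commute)
    also have "\<dots> = map_poly of_int (monom 1 n - 1)"
      by (rule poly_eqI) (simp add: coeff_map_poly)
    finally show ?thesis
      using integral_cofactor[OF lD] by metis
  qed
qed

lemma cyclotomic_eq: "map_poly of_int (cyclotomic n) = cyclotomic_complex n"
  unfolding cyclotomic_def
proof (rule theI')
  show "\<exists>!p. map_poly of_int p = cyclotomic_complex n"
    using cyclotomic_complex_integral[of n] map_poly_of_int_inject by metis
qed

end

(* With N = (n-1)/2 and e = 1 - q^n, a WZ pair telescopes (1-q) times the left-hand side exactly to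
     sum_{m=0}^{N} q^(2m) (q;q^2)_{N+m}^2 (q;q^2)_n / ((q;q)_{n-1}^2 (q;q)_{2m}).
   Its m = 0 term is e times the product over l = 1..N of (1-q^(n-2l)) (1-q^(n+2l)) / (1-q^(2l))^2, whose
   expansion in e^2 gives the two main terms of the right-hand side; the coefficient
   (n^2-1)/24 comes from the sum of z^(2l)/(1-z^(2l))^2 at a primitive n-th root of unity z.
   Every term with m > 0 is e^3 times a unit modulo Phi_n, and at q = z the substitution
   m = N+1-k turns these terms into the sum on the right-hand side.  Divisibility is tested
   locally at every n-th root of unity z != 1 of order d: for d < n only simple vanishing is
   needed, and this follows by counting multiples of d among the exponents. *)

theory Submission
  imports Defs "HOL-Computational_Algebra.Field_as_Ring"
begin

section \<open>A telescoping identity\<close>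

text \<open>The left-hand summand at index 0 is 1, so divisibility by [n] arises only through
  cancellation between summands. The WZ pair trades the sum for boundary terms in which powers of e
  stand as explicit factors. Pairing the exponents n-2l and n+2l leaves no linear term in e in the
  factors of the central product, which is why [n] and [n]^3 occur on the right but no [n]^2. There
  the factored form is used directly: one e is taken out, and the cofactor is shown to have no pole.
  Complex local tests decide divisibility in Z[q] because the modulus is monic: a quotient with
  complex coefficients is then integral. The constant 24, not a unit of Z[q], is invertible in the
  local setting. For n > 1 the point q = 1 is no root of the modulus, so multiplying both sides by
  1-q is harmless.\<close>

lemma qshifted_0 [simp]: "qshifted a q 0 = 1"
  by (simp add: qshifted_def)

lemma qshifted_Suc: "qshifted a q (Suc m) = qshifted a q m * (1 - a * q ^ m)"
  by (simp add: qshifted_def)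

lemma qshifted_nonzero:
  fixes q :: "'a::field"
  assumes "\<And>j. j > 0 \<Longrightarrow> q ^ j \<noteq> 1" "a > 0"
  shows "qshifted (q ^ a) (q ^ b) m \<noteq> 0"
proof -
  have "q ^ a * (q ^ b) ^ i \<noteq> 1" for i
    using assms(1)[of "a + b * i"] assms(2) by (simp add: power_add power_mult)
  then show ?thesis
    by (auto simp: qshifted_def)
qed

lemma qshifted_even_odd:
  fixes q :: "'a::comm_ring_1"
  shows "qshifted q q (2 * m) = qshifted q (q ^ 2) m * qshifted (q ^ 2) (q ^ 2) m"
proof (induction m)
  case (Suc m)
  have "q ^ (2 * m) = (q ^ 2) ^ m" by (simp add: power_mult)
  then show ?case
    using Suc by (simp add: qshifted_Suc power2_eq_square algebra_simps)
qed simp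

lemma qint_times: "(1 - q) * qint q m = 1 - q ^ m"
  unfolding qint_def by (simp add: one_diff_power_eq)

section \<open>The WZ pair and its boundary terms\<close>

context
  fixes q :: "'a::field"
  assumes nz: "\<And>j. j > 0 \<Longrightarrow> q ^ j \<noteq> 1"
begin

text \<open>The terminating quadratic family with first parameter $x = q^{1-2k}$; after normalisation
  the pole of $1/(x;q)_i$ leaves only the terms with $i \ge 2k$, so that the last nonempty
  sum over $i < n$ is a single term.\<close>

private definition H :: "nat \<Rightarrow> nat \<Rightarrow> 'a" where
  "H k i = (if i < 2 * k then 0 else
     (-1) ^ i * (1 - q ^ (3 * i + 1 - 2 * k)) *
       (qshifted q (q ^ 2) (i - k) ^ 2 * qshifted q (q ^ 2) i /
         (qshifted q q i ^ 2 * qshifted q q (i - 2 * k))))"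

text \<open>The WZ companion of \<open>H\<close>: beyond the cutoffs, \<open>G k i / H k i\<close>
  is -q^(i-2k-1) (1-q^i)^2 (1-q^(i-2k)) / ((1-q^(3i+1-2k)) (1-q^(2i-2k-1))^2). The factor 1-q^(i-2k)
  vanishes at i = 2k, which is why the zero range is one longer than that of
  \<open>H\<close>.\<close>

private definition G :: "nat \<Rightarrow> nat \<Rightarrow> 'a" where
  "G k i = (if i < 2 * k + 1 then 0 else
     - ((-1) ^ i * q ^ (i - 1 - 2 * k) *
       (qshifted q (q ^ 2) (i - k - 1) ^ 2 * qshifted q (q ^ 2) i /
         (qshifted q q (i - 1) ^ 2 * qshifted q q (i - 2 * k - 1)))))"

private lemma qsh_nz: "qshifted q q m \<noteq> 0"
  using qshifted_nonzero[of q 1 1, OF nz] by simp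

text \<open>Taking out a common factor leaves a polynomial identity in q, X = q^(2k) and S = q^s,
  where i = 2k+1+s. The edge i = 2k lies outside this parametrisation: there only
  \<open>H k i\<close> and \<open>G k (Suc i)\<close> are nonzero.\<close>

private lemma wz: "H k i - H (Suc k) i = G k (Suc i) - G k i"
proof -
  consider "i < 2 * k" | "i = 2 * k" | s where "i = 2 * k + 1 + s"
    by (metis Suc_eq_plus1 less_linear less_imp_Suc_add add_Suc_shift add_Suc_right)
  then show ?thesis
  proof cases
    case 1
    then show ?thesis by (simp add: H_def G_def)
  next
    case 2
    have e: "3 * (2 * k) + 1 - 2 * k = 4 * k + 1" by simp
    have f: "2 * k - k = k" by simp
    have "q * (q\<^sup>2) ^ (2 * k) = q ^ (4 * k + 1)"
      by (simp add: power_mult [symmetric])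
    then have "1 - q * (q\<^sup>2) ^ (2 * k) = 1 - q ^ (4 * k + 1)" by simp
    then show ?thesis
      using 2 by (simp add: H_def G_def e f qshifted_Suc del: power_Suc)
  next
    case 3
    define a where "a = qshifted q (q ^ 2) (k + s)"
    define b where "b = qshifted q (q ^ 2) i"
    define p where "p = qshifted q q (2 * k + s)"
    define r where "r = qshifted q q s"
    define X where "X = q ^ (2 * k)"
    define S where "S = q ^ s"
    define u where "u = 1 - q * S"
    define v where "v = 1 - q * X * S"
    define sg :: 'a where "sg = (-1) ^ i"
    have nz': "p \<noteq> 0" "r \<noteq> 0"
      by (simp_all add: p_def r_def qsh_nz)
    have u: "u \<noteq> 0" using nz[of "Suc s"] by (simp add: u_def S_def)
    have v: "v \<noteq> 0" using nz[of "Suc (2 * k + s)"] by (simp add: v_def S_def X_def power_add mult.assoc)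
    have pi: "qshifted q q i = p * v"
      using 3 by (simp add: p_def v_def qshifted_Suc X_def S_def power_add mult.assoc)
    have a1: "qshifted q (q ^ 2) (i - k) = a * (1 - q * X * S ^ 2)"
    proof -
      have "i - k = Suc (k + s)" using 3 by simp
      then show ?thesis
        by (simp add: a_def qshifted_Suc X_def S_def power_mult [symmetric] power_add
             add_mult_distrib2 mult.assoc mult.commute[of s 2])
    qed
    have b1: "qshifted q (q ^ 2) (Suc i) = b * (1 - q ^ 3 * X ^ 2 * S ^ 2)"
    proof -
      have "q * (q ^ 2) ^ i = q ^ (1 + 2 * i)"
        by (simp add: power_mult)
      also have "\<dots> = q ^ 3 * X ^ 2 * S ^ 2"
        using 3 by (simp only: X_def S_def power_mult [symmetric] power_add [symmetric])
          (simp add: algebra_simps numeral_3_eq_3)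
      finally have "q * (q ^ 2) ^ i = q ^ 3 * X ^ 2 * S ^ 2" .
      then show ?thesis by (simp add: b_def qshifted_Suc)
    qed
    have r1: "qshifted q q (Suc s) = r * u"
      by (simp add: r_def u_def S_def qshifted_Suc)
    have e1: "q ^ (3 * i + 1 - 2 * k) = q ^ 4 * X ^ 2 * S ^ 3"
      using 3 by (simp add: X_def S_def power_mult [symmetric] power_add [symmetric] algebra_simps)
    have e2: "q ^ (3 * i + 1 - 2 * Suc k) = q ^ 2 * X ^ 2 * S ^ 3"
      using 3 by (simp add: X_def S_def power_mult [symmetric] power_add [symmetric] algebra_simps)
    have H1: "H k i = sg * (1 - q ^ 4 * X ^ 2 * S ^ 3) * ((a * (1 - q * X * S ^ 2)) ^ 2 * b / ((p * v) ^ 2 * (r * u)))"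
    proof -
      have "i - 2 * k = Suc s" using 3 by simp
      then show ?thesis
        unfolding H_def e1 pi a1 using 3 by (simp add: r1 sg_def b_def)
    qed
    \<comment> \<open>For s = 0 the left side is zero by the cutoff in \<open>H\<close>. The factor
      \<open>1 - S\<close>, which for s > 0 converts 1/(q;q)_s into 1/(q;q)_(s-1), vanishes there
      too, so one formula serves both cases.\<close>
    have H2: "H (Suc k) i = sg * (1 - q ^ 2 * X ^ 2 * S ^ 3) * (a ^ 2 * b * (1 - S) / ((p * v) ^ 2 * r))"
    proof (cases s)
      case 0
      then show ?thesis using 3 by (simp add: H_def S_def)
    next
      case (Suc s')
      have "r = qshifted q q s' * (1 - S)"
        using Suc by (simp add: r_def S_def qshifted_Suc)
      moreover have "i - Suc k = k + s" "i - 2 * Suc k = s'" using 3 Suc by simp_all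
      moreover have "\<not> i < 2 * Suc k" using 3 Suc by simp
      ultimately show ?thesis
        unfolding H_def e2 pi using nz'(2) by (simp add: sg_def b_def a_def)
    qed
    have G1: "G k i = - (sg * S * (a ^ 2 * b / (p ^ 2 * r)))"
    proof -
      have "i - 1 - 2 * k = s" "i - k - 1 = k + s" "i - 1 = 2 * k + s" "i - 2 * k - 1 = s" "\<not> i < 2 * k + 1"
        using 3 by simp_all
      then show ?thesis unfolding G_def by (simp add: sg_def S_def a_def b_def p_def r_def)
    qed
    have G2: "G k (Suc i) = sg * (q * S) * ((a * (1 - q * X * S ^ 2)) ^ 2 * (b * (1 - q ^ 3 * X ^ 2 * S ^ 2)) / ((p * v) ^ 2 * (r * u)))"
    proof -
      have "Suc i - 1 - 2 * k = Suc s" "Suc i - k - 1 = i - k" "Suc i - 1 = i" "Suc i - 2 * k - 1 = Suc s" "\<not> Suc i < 2 * k + 1"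
        using 3 by simp_all
      then show ?thesis unfolding G_def by (simp only: a1 b1 pi r1 if_False) (simp add: sg_def S_def)
    qed
    have key: "(1 - q ^ 4 * X ^ 2 * S ^ 3) * (1 - q * X * S ^ 2) ^ 2 - (1 - q ^ 2 * X ^ 2 * S ^ 3) * (1 - S) * u
      = q * S * (1 - q * X * S ^ 2) ^ 2 * (1 - q ^ 3 * X ^ 2 * S ^ 2) + S * v ^ 2 * u"
      unfolding u_def v_def by algebra
    define c where "c = sg * a ^ 2 * b / (p ^ 2 * r * v ^ 2 * u)"
    have "H k i = c * ((1 - q ^ 4 * X ^ 2 * S ^ 3) * (1 - q * X * S ^ 2) ^ 2)"
      "H (Suc k) i = c * ((1 - q ^ 2 * X ^ 2 * S ^ 3) * (1 - S) * u)"
      "G k (Suc i) = c * (q * S * (1 - q * X * S ^ 2) ^ 2 * (1 - q ^ 3 * X ^ 2 * S ^ 2))"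
      "G k i = - (c * (S * v ^ 2 * u))"
      unfolding H1 H2 G1 G2 c_def using nz' u v by (simp_all add: power_mult_distrib frac_eq_eq)
    then show ?thesis
      using key by (metis (no_types, lifting) diff_minus_eq_add distrib_left right_diff_distrib')
  qed
qed

text \<open>Summing the WZ relation over i < n leaves one boundary term per k, because
  \<open>G k 0\<close> is zero. The reversal k = N - m turns these boundary terms into the
  right-hand summands.\<close>

lemma cubic_sum_eq:
  assumes "n = 2 * N + 1"
  shows "(\<Sum>i<n. (-1) ^ i * (1 - q ^ (3 * i + 1)) * (qshifted q (q ^ 2) i ^ 3 / qshifted q q i ^ 3))
    = (\<Sum>m\<le>N. q ^ (2 * m) * (qshifted q (q ^ 2) (N + m) ^ 2 * qshifted q (q ^ 2) n /
        (qshifted q q (2 * N) ^ 2 * qshifted q q (2 * m))))"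
proof -
  define T where "T k = (\<Sum>i<n. H k i)" for k
  have step: "T k - T (Suc k) = G k n" for k
  proof -
    have "T k - T (Suc k) = (\<Sum>i<n. G k (Suc i) - G k i)"
      unfolding T_def by (simp add: wz flip: sum_subtractf)
    also have "\<dots> = G k n - G k 0" by (rule sum_lessThan_telescope)
    finally show ?thesis by (simp add: G_def)
  qed
  have "(\<Sum>k<Suc N. T (Suc k) - T k) = T (Suc N) - T 0" by (rule sum_lessThan_telescope)
  \<comment> \<open>Every index i < 2N+1 lies below the cutoff 2(N+1), so the chain of differences
    ends at k = N.\<close>
  moreover have "T (Suc N) = 0"
    unfolding T_def using assms by (intro sum.neutral) (auto simp: H_def)
  ultimately have "T 0 = - (\<Sum>k<Suc N. T (Suc k) - T k)" by simp
  also have "\<dots> = (\<Sum>k<Suc N. G k n)"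
    by (simp add: step flip: sum_negf)
  also have "\<dots> = (\<Sum>m<Suc N. G (Suc N - Suc m) n)"
    by (rule sum.nat_diff_reindex [symmetric])
  also have "\<dots> = (\<Sum>m\<le>N. q ^ (2 * m) * (qshifted q (q ^ 2) (N + m) ^ 2 * qshifted q (q ^ 2) n /
        (qshifted q q (2 * N) ^ 2 * qshifted q q (2 * m))))"
  proof (rule sum.cong)
    fix m assume "m \<in> {..N}"
    then have "n - 1 - 2 * (Suc N - Suc m) = 2 * m" "n - (Suc N - Suc m) - 1 = N + m" "n - 1 = 2 * N"
       "n - 2 * (Suc N - Suc m) - 1 = 2 * m" "\<not> n < 2 * (Suc N - Suc m) + 1"
      using assms by auto
    moreover have "(- 1 :: 'a) ^ n = - 1" using assms by simp
    ultimately show "G (Suc N - Suc m) n = q ^ (2 * m) * (qshifted q (q ^ 2) (N + m) ^ 2 * qshifted q (q ^ 2) n /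
        (qshifted q q (2 * N) ^ 2 * qshifted q q (2 * m)))"
      unfolding G_def by (simp only: if_False) simp
  qed auto
  also have "T 0 = (\<Sum>i<n. (-1) ^ i * (1 - q ^ (3 * i + 1)) * (qshifted q (q ^ 2) i ^ 3 / qshifted q q i ^ 3))"
    unfolding T_def H_def by (intro sum.cong) (auto simp: power2_eq_square power3_eq_cube)
  finally show ?thesis .
qed

end

section \<open>Local behaviour of rational functions at a complex number\<close>

definition eval_at :: "complex \<Rightarrow> int poly \<Rightarrow> complex" where
  "eval_at z p = poly (map_poly of_int p) z"

definition has_value :: "complex \<Rightarrow> int poly fract \<Rightarrow> complex \<Rightarrow> bool" where
  "has_value z x c \<longleftrightarrow>
     (\<exists>u v. x = to_fract u / to_fract v \<and> eval_at z v \<noteq> 0 \<and> eval_at z u = c * eval_at z v)"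

definition vanishes :: "complex \<Rightarrow> nat \<Rightarrow> int poly fract \<Rightarrow> bool" where
  "vanishes z e x \<longleftrightarrow>
     (\<exists>u v. x = to_fract u / to_fract v \<and> eval_at z v \<noteq> 0 \<and> [:- z, 1:] ^ e dvd map_poly of_int u)"

definition regular :: "complex \<Rightarrow> int poly fract \<Rightarrow> bool" where
  "regular z x \<longleftrightarrow> (\<exists>c. has_value z x c)"

lemma map_poly_of_int_add:
  "map_poly of_int (p + q) = (map_poly of_int p + map_poly of_int q :: complex poly)"
  by (rule poly_eqI) (simp add: coeff_map_poly)

lemma eval_at_simps [simp]:
  "eval_at z 0 = 0" "eval_at z 1 = 1" "eval_at z (p * q) = eval_at z p * eval_at z q"
  "eval_at z (p + q) = eval_at z p + eval_at z q" "eval_at z (of_int a) = of_int a"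
  "eval_at z qP = z"
  by (simp_all add: eval_at_def map_poly_of_int_mult map_poly_of_int_add of_int_poly map_poly_pCons qP_def)

lemma to_fract_of_int: "to_fract (of_int a) = of_int a"
proof -
  have *: "to_fract (of_nat m) = of_nat m" for m
    by (induction m) simp_all
  show ?thesis
    by (cases a rule: int_cases2) (simp_all add: *)
qed

lemma eval_at_nonzeroD: "eval_at z v \<noteq> 0 \<Longrightarrow> to_fract v \<noteq> 0"
  by auto

lemma has_value_of_int: "has_value z (of_int a) (of_int a)"
  unfolding has_value_def by (intro exI[of _ "of_int a"] exI[of _ 1]) (simp add: to_fract_of_int)

lemma has_value_0: "has_value z 0 0" and has_value_1: "has_value z 1 1"
  using has_value_of_int[of z 0] has_value_of_int[of z 1] by simp_all

lemma has_value_numeral: "has_value z (numeral k) (numeral k)"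
  using has_value_of_int[of z "numeral k"] by simp

lemma has_value_qR: "has_value z qR z"
  unfolding has_value_def by (intro exI[of _ qP] exI[of _ 1]) (simp add: qR_def)

lemma has_value_add:
  assumes "has_value z x a" "has_value z y b"
  shows "has_value z (x + y) (a + b)"
proof -
  from assms obtain u v u' v' where
    *: "x = to_fract u / to_fract v" "eval_at z v \<noteq> 0" "eval_at z u = a * eval_at z v"
       "y = to_fract u' / to_fract v'" "eval_at z v' \<noteq> 0" "eval_at z u' = b * eval_at z v'"
    unfolding has_value_def by blast
  show ?thesis
    unfolding has_value_def
    by (intro exI[of _ "u * v' + u' * v"] exI[of _ "v * v'"])
       (use * eval_at_nonzeroD[of z v] eval_at_nonzeroD[of z v'] in
         \<open>auto simp: field_simps\<close>)
qed

lemma has_value_mult: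
  assumes "has_value z x a" "has_value z y b"
  shows "has_value z (x * y) (a * b)"
proof -
  from assms obtain u v u' v' where
    *: "x = to_fract u / to_fract v" "eval_at z v \<noteq> 0" "eval_at z u = a * eval_at z v"
       "y = to_fract u' / to_fract v'" "eval_at z v' \<noteq> 0" "eval_at z u' = b * eval_at z v'"
    unfolding has_value_def by blast
  show ?thesis
    unfolding has_value_def
    by (intro exI[of _ "u * u'"] exI[of _ "v * v'"]) (use * in auto)
qed

lemma has_value_inverse:
  assumes "has_value z x a" "a \<noteq> 0"
  shows "has_value z (inverse x) (inverse a)"
proof -
  from assms obtain u v where
    *: "x = to_fract u / to_fract v" "eval_at z v \<noteq> 0" "eval_at z u = a * eval_at z v"
    unfolding has_value_def by blast
  show ?thesis
    unfolding has_value_def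
    by (intro exI[of _ v] exI[of _ u]) (use * assms(2) in auto)
qed

lemma has_value_divide:
  "has_value z x a \<Longrightarrow> has_value z y b \<Longrightarrow> b \<noteq> 0 \<Longrightarrow> has_value z (x / y) (a / b)"
  unfolding divide_inverse by (intro has_value_mult has_value_inverse)

lemma has_value_minus: "has_value z x a \<Longrightarrow> has_value z (- x) (- a)"
  using has_value_mult[OF has_value_of_int[of z "-1"]] by simp

lemma has_value_diff:
  "has_value z x a \<Longrightarrow> has_value z y b \<Longrightarrow> has_value z (x - y) (a - b)"
  using has_value_add[OF _ has_value_minus] by fastforce

lemma has_value_power: "has_value z x a \<Longrightarrow> has_value z (x ^ m) (a ^ m)"
  by (induction m) (auto intro: has_value_mult has_value_1)

lemma has_value_sum:
  "(\<And>i. i \<in> A \<Longrightarrow> has_value z (f i) (g i)) \<Longrightarrow> has_value z (sum f A) (sum g A)"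
  by (induction A rule: infinite_finite_induct) (auto intro: has_value_add has_value_0)

lemma has_value_prod:
  "(\<And>i. i \<in> A \<Longrightarrow> has_value z (f i) (g i)) \<Longrightarrow> has_value z (prod f A) (prod g A)"
  by (induction A rule: infinite_finite_induct) (auto intro: has_value_mult has_value_1)

lemma has_value_powi:
  "has_value z x a \<Longrightarrow> a \<noteq> 0 \<Longrightarrow> has_value z (x powi m) (a powi m)"
  unfolding power_int_def by (auto intro: has_value_power has_value_inverse)

lemmas has_value_intros =
  has_value_of_int has_value_0 has_value_1 has_value_numeral has_value_qR has_value_add
  has_value_mult has_value_inverse has_value_divide has_value_minus has_value_diff
  has_value_power has_value_sum has_value_prod has_value_powi

lemma regular_closed:
  "regular z 0" "regular z 1" "regular z qR" "regular z (of_int k)"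
  "regular z x \<Longrightarrow> regular z y \<Longrightarrow> regular z (x + y)"
  "regular z x \<Longrightarrow> regular z y \<Longrightarrow> regular z (x - y)"
  "regular z x \<Longrightarrow> regular z y \<Longrightarrow> regular z (x * y)"
  "regular z x \<Longrightarrow> regular z (- x)"
  "regular z x \<Longrightarrow> regular z (x ^ m)"
  unfolding regular_def by (blast intro: has_value_intros)+

lemma regular_sum: "(\<And>i. i \<in> A \<Longrightarrow> regular z (f i)) \<Longrightarrow> regular z (sum f A)"
  by (induction A rule: infinite_finite_induct) (auto intro: regular_closed)

lemma regular_prod: "(\<And>i. i \<in> A \<Longrightarrow> regular z (f i)) \<Longrightarrow> regular z (prod f A)"
  by (induction A rule: infinite_finite_induct) (auto intro: regular_closed)

lemma vanishes_0_iff: "vanishes z 0 x \<longleftrightarrow> regular z x"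
proof
  assume "vanishes z 0 x"
  then obtain u v where "x = to_fract u / to_fract v" "eval_at z v \<noteq> 0"
    by (auto simp: vanishes_def)
  then have "has_value z x (eval_at z u / eval_at z v)"
    unfolding has_value_def by (intro exI[of _ u] exI[of _ v]) auto
  then show "regular z x" by (auto simp: regular_def)
qed (auto simp: regular_def has_value_def vanishes_def)

lemma vanishes_1: "has_value z x 0 \<Longrightarrow> vanishes z 1 x"
  unfolding has_value_def vanishes_def by (auto simp: eval_at_def poly_eq_0_iff_dvd)

lemma vanishes_mult:
  assumes "vanishes z e x" "vanishes z f y"
  shows "vanishes z (e + f) (x * y)"
proof -
  from assms obtain u v u' v' where
    *: "x = to_fract u / to_fract v" "eval_at z v \<noteq> 0" "[:- z, 1:] ^ e dvd map_poly of_int u"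
       "y = to_fract u' / to_fract v'" "eval_at z v' \<noteq> 0" "[:- z, 1:] ^ f dvd map_poly of_int u'"
    unfolding vanishes_def by blast
  show ?thesis
    unfolding vanishes_def
    by (intro exI[of _ "u * u'"] exI[of _ "v * v'"])
       (use * in \<open>auto simp: map_poly_of_int_mult power_add intro: mult_dvd_mono\<close>)
qed

lemma vanishes_power: "vanishes z 1 x \<Longrightarrow> vanishes z e (x ^ e)"
proof (induction e)
  case (Suc e)
  then show ?case
    using vanishes_mult[of z 1 x e "x ^ e"] by simp
qed (simp add: vanishes_0_iff regular_closed)

text \<open>In P v = u Q the power of X - z divides u and is coprime to v, so it must divide P. This
  links the free choice of representation to the reduced numerator in
  \<open>rat_cong\<close>.\<close>

lemma vanishes_numerator:
  assumes "vanishes z e x"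
  shows "[:- z, 1:] ^ e dvd map_poly of_int (fst (quot_of_fract x))"
proof -
  from assms obtain u v where uv: "x = to_fract u / to_fract v" "eval_at z v \<noteq> 0"
     and dvd: "[:- z, 1:] ^ e dvd map_poly of_int u"
    by (auto simp: vanishes_def)
  obtain P Q where PQ: "quot_of_fract x = (P, Q)" by fastforce
  have "Q \<noteq> 0" using snd_quot_of_fract_nonzero[of x] PQ by simp
  have "x = to_fract P / to_fract Q"
    using Fract_quot_of_fract[of x] PQ by (simp add: Fract_conv_to_fract)
  then have "to_fract (P * v) = to_fract (u * Q)"
    using uv eval_at_nonzeroD[OF uv(2)] \<open>Q \<noteq> 0\<close> by (simp add: field_simps)
  then have "P * v = u * Q" by (simp only: to_fract_eq_iff)
  then have "map_poly of_int P * map_poly of_int v = (map_poly of_int u * map_poly of_int Q :: complex poly)"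
    by (metis map_poly_of_int_mult)
  then have "[:- z, 1:] ^ e dvd map_poly of_int P * map_poly of_int v"
    using dvd by simp
  moreover have "coprime ([:- z, 1:] ^ e) (map_poly of_int v)"
  proof -
    have "coprime [:- z, 1:] (map_poly of_int v :: complex poly)"
      by (rule prime_elem_imp_coprime [OF prime_elem_linear_field_poly])
         (use uv(2) in \<open>auto simp: eval_at_def poly_eq_0_iff_dvd\<close>)
    then show ?thesis by (simp add: coprime_power_left_iff)
  qed
  ultimately show ?thesis
    by (simp add: coprime_dvd_mult_left_iff PQ)
qed


section \<open>From local vanishing to divisibility in Z[q]\<close>

text \<open>Dividing by a monic integer polynomial never leaves the integers, so the complex
  quotient already has integer coefficients.\<close>

lemma monic_dvd_of_complex_dvd:
  fixes D P :: "int poly"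
  assumes "lead_coeff D = 1" "map_poly of_int D dvd (map_poly of_int P :: complex poly)"
  shows "D dvd P"
proof -
  from assms(2) obtain F where "map_poly of_int P = map_poly of_int D * (F :: complex poly)" ..
  with integral_cofactor[OF assms(1), of F P] obtain G where "F = map_poly of_int G" by auto
  with \<open>map_poly of_int P = map_poly of_int D * F\<close> have "P = D * G"
    by (metis map_poly_of_int_mult map_poly_of_int_inject)
  then show ?thesis by simp
qed

lemma prod_dvd_of_coprime:
  fixes f :: "'a \<Rightarrow> complex poly"
  assumes "finite A" "\<And>i j. i \<in> A \<Longrightarrow> j \<in> A \<Longrightarrow> i \<noteq> j \<Longrightarrow> coprime (f i) (f j)"
    "\<And>i. i \<in> A \<Longrightarrow> f i dvd c"
  shows "prod f A dvd c"
  using assms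
proof (induction A)
  case (insert x A)
  have "coprime (f x) (prod f A)"
    by (rule prod_coprime_right) (use insert.prems(1) insert.hyps in auto)
  then show ?case
    using insert by (simp add: divides_mult)
qed simp

lemma qint_poly_factorization:
  assumes "n > 0"
  shows "map_poly of_int (qint qP n) = (\<Prod>k\<in>{1..<n}. [:- cis (2 * pi * real k / real n), 1:])"
proof -
  let ?f = "\<lambda>k. [:- cis (2 * pi * real k / real n), 1:]"
  have "(qP - 1) * qint qP n = qP ^ n - 1"
    using qint_times[of qP n] by (simp add: algebra_simps)
  moreover have "qP ^ n = monom 1 n"
    by (simp add: qP_def monom_altdef)
  moreover have "map_poly of_int (monom 1 n - 1) = (monom 1 n - 1 :: complex poly)"
    by (rule poly_eqI) (simp add: coeff_map_poly)
  ultimately have "map_poly of_int (qP - 1) * map_poly of_int (qint qP n) = (monom 1 n - 1 :: complex poly)"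
    by (metis map_poly_of_int_mult)
  also have "\<dots> = (\<Prod>k\<in>{1..n}. ?f k)"
    by (rule prod_roots_of_unity [OF assms, symmetric])
  also have "{1..n} = insert n {1..<n}" using assms by auto
  also have "prod ?f \<dots> = ?f n * prod ?f {1..<n}" by simp
  also have "?f n = map_poly of_int (qP - 1)"
    using assms by (simp add: qP_def map_poly_pCons one_pCons)
  finally show ?thesis
    by (simp add: map_poly_of_int_inject [of _ 0, simplified] qP_def one_pCons)
qed

text \<open>For n > 1 the index k = n is not coprime to n and drops out. Filling up with factors 1
  gives the index set of the factorization of [n], so that the two products multiply
  termwise.\<close>

lemma cyclotomic_complex_alt:
  assumes "n > 1"
  shows "cyclotomic_complex n =
    (\<Prod>k\<in>{1..<n}. if coprime k n then [:- cis (2 * pi * real k / real n), 1:] else 1)"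
proof -
  have "{k. 1 \<le> k \<and> k \<le> n \<and> gcd k n = 1} = {k \<in> {1..<n}. coprime k n}"
    using assms by (auto simp: coprime_iff_gcd_eq_1 order_less_le)
  moreover have "cis (2 * pi / real n) ^ k = cis (2 * pi * real k / real n)" for k
    by (simp add: Complex.DeMoivre mult_ac)
  ultimately show ?thesis
    unfolding cyclotomic_complex_def by (simp only: prod.inter_filter [OF finite_atLeastLessThan])
qed

text \<open>The exponents are the multiplicities in the modulus: every n-th root of unity other than
  1 is a simple root of [n], and the primitive ones gain three more from the cube of Phi_n. Powers
  of distinct linear factors are coprime, so the local conditions combine.\<close>

lemma rat_congI:
  assumes "n > 1"
    and "\<And>k. 1 \<le> k \<Longrightarrow> k < n \<Longrightarrow>
      vanishes (cis (2 * pi * real k / real n)) (if coprime k n then 4 else 1) (A - B)"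
  shows "rat_cong A B (qint qP n * cyclotomic n ^ 3)"
proof -
  let ?z = "\<lambda>k. cis (2 * pi * real k / real n)"
  let ?f = "\<lambda>k. [:- ?z k, 1:] ^ (if coprime k n then 4 else 1)"
  let ?D = "qint qP n * cyclotomic n ^ 3"
  let ?P = "fst (quot_of_fract (A - B))"
  have "map_poly of_int ?D = (map_poly of_int (qint qP n) * cyclotomic_complex n ^ 3 :: complex poly)"
    by (simp add: map_poly_of_int_mult cyclotomic_eq numeral_3_eq_3)
  also have "\<dots> = prod ?f {1..<n}"
    using assms(1) unfolding cyclotomic_complex_alt[OF assms(1)]
    by (subst qint_poly_factorization)
       (auto simp: eval_nat_numeral simp flip: prod_power_distrib prod.distrib intro!: prod.cong)
  finally have D: "map_poly of_int ?D = prod ?f {1..<n}" .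
  have "complex_of_int (lead_coeff ?D) = 1"
    unfolding lead_coeff_map_poly_of_int[symmetric] D lead_coeff_prod lead_coeff_power by simp
  then have "lead_coeff ?D = 1" by (simp only: of_int_eq_1_iff)
  moreover have "prod ?f {1..<n} dvd map_poly of_int ?P"
  proof (rule prod_dvd_of_coprime)
    fix i j assume ij: "i \<in> {1..<n}" "j \<in> {1..<n}" "i \<noteq> j"
    have "inj_on (\<lambda>k. cis (2 * pi * real k / real n)) {..<n}"
      using bij_betw_roots_unity[of n] assms(1) by (simp add: bij_betw_def)
    with ij have "?z i \<noteq> ?z j" by (auto simp: inj_on_def)
    then have "\<not> [:- ?z i, 1:] dvd [:- ?z j, 1:]"
      by (simp add: poly_eq_0_iff_dvd [symmetric])
    then have "coprime [:- ?z i, 1:] [:- ?z j, 1:]"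
      by (intro prime_elem_imp_coprime [OF prime_elem_linear_field_poly]) auto
    then show "coprime (?f i) (?f j)"
      by simp
  next
    fix i assume "i \<in> {1..<n}"
    then show "?f i dvd map_poly of_int ?P"
      using assms(2)[of i] by (intro vanishes_numerator) auto
  qed simp
  ultimately show ?thesis
    unfolding rat_cong_def by (intro monic_dvd_of_complex_dvd) (simp_all only: D)
qed

section \<open>Factorization and sums over roots of unity\<close>

lemma prod_neg_odd_powers:
  fixes q :: "'a::comm_ring_1"
  shows "(\<Prod>i<N. - (q ^ (2 * i + 1))) = (-1) ^ N * q ^ N ^ 2"
proof (induction N)
  case (Suc N)
  have "Suc N ^ 2 = N ^ 2 + (2 * N + 1)" by (simp add: power2_eq_square)
  then show ?case using Suc by (simp add: power_add mult_ac)
qed simp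

lemma qshifted_odd_add:
  fixes q :: "'a::comm_ring_1"
  shows "qshifted q (q ^ 2) (N + m) = qshifted q (q ^ 2) N * (\<Prod>l<m. 1 - q ^ (2 * N + 1 + 2 * l))"
proof (induction m)
  case (Suc m)
  have "q * (q ^ 2) ^ (N + m) = q ^ (2 * N + 1 + 2 * m)"
    by (simp add: power_mult [symmetric] power_add [symmetric] mult_ac)
  then show ?case using Suc by (simp add: qshifted_Suc mult_ac)
qed simp

text \<open>Reversing (q;q^2)_N pairs the exponents n-2l and n+2l. With y = q^(2l) and u = q^(n-2l),
  hence uy = q^n, one has (1-u)(1-uy^2) = (1-uy)^2 - u(1-y)^2. Dividing by (1-y)^2 gives -u times 1
  minus a multiple of (1-q^n)^2, and the monomials -u collect to (-1)^N q^(N^2).\<close>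

lemma central_quotient:
  fixes q :: "'a::field"
  assumes nz: "\<And>j. j > 0 \<Longrightarrow> q ^ j \<noteq> 1" and "q \<noteq> 0" and n: "n = 2 * N + 1"
  shows "qshifted q (q ^ 2) N * (\<Prod>l<Suc N. 1 - q ^ (n + 2 * l)) / qshifted (q ^ 2) (q ^ 2) N ^ 2
    = (1 - q ^ n) * ((-1) ^ N * q ^ N ^ 2 *
        (\<Prod>i<N. 1 - (1 - q ^ n) ^ 2 * (q ^ (2 * Suc i) / (q ^ n * (1 - q ^ (2 * Suc i)) ^ 2))))"
proof -
  let ?e = "1 - q ^ n"
  let ?a = "\<lambda>i. q ^ (2 * Suc i) / (q ^ n * (1 - q ^ (2 * Suc i)) ^ 2)"
  have o: "qshifted q (q ^ 2) N = (\<Prod>i<N. 1 - q ^ (2 * (N - Suc i) + 1))"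
  proof -
    have "qshifted q (q ^ 2) N = (\<Prod>i<N. 1 - q ^ (2 * i + 1))"
      by (simp add: qshifted_def power_mult)
    also have "\<dots> = (\<Prod>i<N. 1 - q ^ (2 * (N - Suc i) + 1))"
      by (rule prod.nat_diff_reindex [symmetric])
    finally show ?thesis .
  qed
  have t: "qshifted (q ^ 2) (q ^ 2) N = (\<Prod>i<N. 1 - q ^ (2 * Suc i))"
  proof -
    have "q ^ 2 * (q ^ 2) ^ i = q ^ (2 * Suc i)" for i
      by (simp only: power_mult power_Suc)
    then show ?thesis by (simp add: qshifted_def)
  qed
  have step: "(1 - q ^ (2 * (N - Suc i) + 1)) * (1 - q ^ (n + 2 * Suc i)) / (1 - q ^ (2 * Suc i)) ^ 2
     = - (q ^ (2 * (N - Suc i) + 1)) * (1 - ?e ^ 2 * ?a i)" if "i < N" for i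
  proof -
    define y where "y = q ^ (2 * Suc i)"
    define u where "u = q ^ (2 * (N - Suc i) + 1)"
    have "2 * (N - Suc i) + 1 + 2 * Suc i = n" using that n by simp
    then have uy: "q ^ n = u * y" by (metis power_add u_def y_def)
    have "y \<noteq> 0" "u \<noteq> 0" using \<open>q \<noteq> 0\<close> by (simp_all add: y_def u_def)
    moreover have "1 - y \<noteq> 0" using nz[of "2 * Suc i"] by (simp add: y_def)
    ultimately have "(1 - u) * (1 - u * y * y) / (1 - y) ^ 2 = - (u) * (1 - (1 - u * y) ^ 2 * (y / (u * y * (1 - y) ^ 2)))"
      by (simp add: divide_simps) algebra
    then show ?thesis
      unfolding power_add[of q n] uy y_def[symmetric] u_def[symmetric] .
  qed
  have "(\<Prod>l<Suc N. 1 - q ^ (n + 2 * l)) = ?e * (\<Prod>i<N. 1 - q ^ (n + 2 * Suc i))"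
    by (simp only: prod.lessThan_Suc_shift) simp
  then have "qshifted q (q ^ 2) N * (\<Prod>l<Suc N. 1 - q ^ (n + 2 * l)) / qshifted (q ^ 2) (q ^ 2) N ^ 2
    = ?e * (\<Prod>i<N. (1 - q ^ (2 * (N - Suc i) + 1)) * (1 - q ^ (n + 2 * Suc i)) / (1 - q ^ (2 * Suc i)) ^ 2)"
    unfolding o t by (simp only: prod_dividef prod.distrib prod_power_distrib) (simp only: times_divide_eq_right mult.left_commute)
  also have "\<dots> = ?e * (\<Prod>i<N. - (q ^ (2 * (N - Suc i) + 1)) * (1 - ?e ^ 2 * ?a i))"
    by (intro arg_cong2[of _ _ _ _ "(*)"] prod.cong refl step) simp
  also have "\<dots> = ?e * ((\<Prod>i<N. - (q ^ (2 * (N - Suc i) + 1))) * (\<Prod>i<N. 1 - ?e ^ 2 * ?a i))"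
    by (simp only: prod.distrib)
  also have "(\<Prod>i<N. - (q ^ (2 * (N - Suc i) + 1))) = (\<Prod>i<N. - (q ^ (2 * i + 1)))"
    by (rule prod.nat_diff_reindex)
  finally show ?thesis
    by (simp only: prod_neg_odd_powers)
qed

text \<open>The product of 1-q^(n+2l) over l < m occurs squared, and (q;q)_(2m) = (q;q^2)_m
  (q^2;q^2)_m takes one copy for each half. Every resulting quotient has m factors above and m
  below, the form in which poles can be counted.\<close>

lemma cubic_sum_factored:
  fixes q :: "'a::field"
  assumes nz: "\<And>j. j > 0 \<Longrightarrow> q ^ j \<noteq> 1" and "q \<noteq> 0" and n: "n = 2 * N + 1"
  shows "(\<Sum>i<n. (-1) ^ i * (1 - q ^ (3 * i + 1)) * (qshifted q (q ^ 2) i ^ 3 / qshifted q q i ^ 3))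
    = (1 - q ^ n) * ((-1) ^ N * q ^ N ^ 2 *
        (\<Prod>i<N. 1 - (1 - q ^ n) ^ 2 * (q ^ (2 * Suc i) / (q ^ n * (1 - q ^ (2 * Suc i)) ^ 2)))) *
      (\<Sum>m\<le>N. q ^ (2 * m) * ((\<Prod>l<m. 1 - q ^ (n + 2 * l)) / qshifted (q ^ 2) (q ^ 2) m) *
        ((\<Prod>l<m. 1 - q ^ (n + 2 * l)) / qshifted q (q ^ 2) m))"
proof -
  have o: "qshifted q (q ^ 2) m \<noteq> 0" and t: "qshifted (q ^ 2) (q ^ 2) m \<noteq> 0" for m
    using qshifted_nonzero[of q 1 2 m] qshifted_nonzero[of q 2 2 m] nz by simp_all
  have s: "qshifted q (q ^ 2) (N + m) = qshifted q (q ^ 2) N * (\<Prod>l<m. 1 - q ^ (n + 2 * l))" for m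
    using qshifted_odd_add[of q N m] n by simp
  have "n = N + Suc N" using n by simp
  then have sn: "qshifted q (q ^ 2) n = qshifted q (q ^ 2) N * (\<Prod>l<Suc N. 1 - q ^ (n + 2 * l))"
    using s[of "Suc N"] by metis
  let ?D = "\<lambda>m. \<Prod>l<m. 1 - q ^ (n + 2 * l)"
  have "q ^ (2 * m) * (qshifted q (q ^ 2) (N + m) ^ 2 * qshifted q (q ^ 2) n /
      (qshifted q q (2 * N) ^ 2 * qshifted q q (2 * m))) =
    qshifted q (q ^ 2) N * ?D (Suc N) / qshifted (q ^ 2) (q ^ 2) N ^ 2 *
      (q ^ (2 * m) * (?D m / qshifted (q ^ 2) (q ^ 2) m) * (?D m / qshifted q (q ^ 2) m))" for m
    unfolding qshifted_even_odd s sn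
    using o[of N] t[of N] o[of m] t[of m]
    by (simp only: power_mult_distrib power2_eq_square) (simp add: field_simps del: prod.lessThan_Suc)
  then show ?thesis
    by (simp only: cubic_sum_eq [OF nz n] central_quotient [OF nz \<open>q \<noteq> 0\<close> n, symmetric] sum_distrib_left)
qed

section \<open>Quadratic sums over roots of unity\<close>

lemma weighted_geometric_sum:
  fixes y :: complex
  shows "(1 - y) * (\<Sum>r<Suc m. of_nat r * y ^ r) = (\<Sum>r<Suc m. y ^ r) - 1 - of_nat m * y ^ Suc m"
  by (induction m) (simp_all add: algebra_simps)

lemma geometric_sum_root:
  fixes y :: complex
  assumes "y ^ n = 1" "y \<noteq> 1"
  shows "(\<Sum>r<n. y ^ r) = 0"
  using assms by (simp add: geometric_sum)

lemma sum_squares: "6 * (\<Sum>r<n. of_nat r ^ 2) = of_nat n * (of_nat n - 1) * (2 * of_nat n - 1 :: complex)"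
  by (induction n) (simp_all add: algebra_simps power2_eq_square)

lemma sum_naturals: "2 * (\<Sum>r<n. of_nat r) = of_nat n * (of_nat n - 1 :: complex)"
  by (induction n) (simp_all add: algebra_simps)

text \<open>Parseval's identity for the discrete Fourier transform of $r \mapsto r$ on
  $\{0, \dots, n-1\}$, whose value at $j \neq 0$ is $n / (w^j - 1)$.\<close>

lemma sum_root_of_unity_full:
  fixes w :: complex
  assumes "n > 0" and w: "\<And>j. w ^ j = 1 \<longleftrightarrow> n dvd j"
  shows "(\<Sum>j\<in>{1..<n}. w ^ j / (1 - w ^ j) ^ 2) = - (of_nat n ^ 2 - 1) / 12"
proof -
  define v where "v = inverse w"
  have "w \<noteq> 0" using w[of n] \<open>n > 0\<close> by (auto simp: power_0_left)
  have vw: "v ^ j = inverse (w ^ j)" for j by (simp add: v_def power_inverse)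
  define A where "A j = (\<Sum>r<n. of_nat r * (w ^ j) ^ r)" for j
  define B where "B j = (\<Sum>r<n. of_nat r * (v ^ j) ^ r)" for j
  have fourier: "(y - 1) * (\<Sum>r<n. of_nat r * y ^ r) = of_nat n" if "y ^ n = 1" "y \<noteq> 1" for y :: complex
  proof -
    obtain m where m: "n = Suc m" using \<open>n > 0\<close> gr0_implies_Suc by blast
    show ?thesis
      using weighted_geometric_sum[of y m] geometric_sum_root[OF that] that(1)
      unfolding m by (simp add: algebra_simps)
  qed
  have AB: "A j * B j = - (of_nat n ^ 2) * (w ^ j / (1 - w ^ j) ^ 2)" if "j \<in> {1..<n}" for j
  proof -
    have ne: "w ^ j \<noteq> 1" using that w[of j] by (auto dest: dvd_imp_le)
    have "(w ^ j) ^ n = 1" by (metis dvd_triv_right power_mult w)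
    moreover have "(v ^ j) ^ n = 1" using calculation by (simp add: vw power_inverse)
    moreover have "v ^ j \<noteq> 1" using ne by (simp add: vw inverse_eq_1_iff)
    ultimately have a: "(w ^ j - 1) * A j = of_nat n" and b: "(v ^ j - 1) * B j = of_nat n"
      using fourier[of "w ^ j"] fourier[of "v ^ j"] ne by (simp_all add: A_def B_def)
    \<comment> \<open>The two inverse factors multiply to the reciprocal of the wanted summand, up
      to sign.\<close>
    have "(w ^ j - 1) * (v ^ j - 1) = - ((1 - w ^ j) ^ 2 / w ^ j)"
      using \<open>w \<noteq> 0\<close> by (simp add: vw field_simps power2_eq_square)
    then have "of_nat n ^ 2 = - ((1 - w ^ j) ^ 2 / w ^ j) * (A j * B j)"
      using a b by (metis (no_types, lifting) mult.assoc mult.left_commute power2_eq_square)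
    then show ?thesis using ne \<open>w \<noteq> 0\<close> by (simp add: field_simps)
  qed
  have orth: "(\<Sum>j<n. (w ^ j) ^ r * (v ^ j) ^ s) = (if r = s then of_nat n else 0)"
    if "r < n" "s < n" for r s
  proof -
    have e: "(w ^ j) ^ r * (v ^ j) ^ s = (w ^ r * v ^ s) ^ j" for j
      by (simp add: power_mult [symmetric] power_mult_distrib mult.commute)
    show ?thesis
    proof (cases "r = s")
      case True
      then show ?thesis unfolding e using \<open>w \<noteq> 0\<close> by (simp add: vw)
    next
      case False
      have "w ^ r \<noteq> w ^ s"
      proof
        assume eq: "w ^ r = w ^ s"
        have "w ^ (max r s - min r s) = 1"
          using eq \<open>w \<noteq> 0\<close> by (simp add: power_diff max_def min_def)
        then have "n dvd max r s - min r s" using w by blast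
        then show False using that False by (auto dest!: dvd_imp_le)
      qed
      then have "w ^ r * v ^ s \<noteq> 1" using \<open>w \<noteq> 0\<close> by (simp add: vw field_simps)
      moreover have "(w ^ r * v ^ s) ^ n = 1"
      proof -
        have "(w ^ r) ^ n = 1" "(w ^ s) ^ n = 1" by (metis dvd_triv_right power_mult w)+
        then show ?thesis by (simp add: vw power_mult_distrib power_inverse)
      qed
      ultimately show ?thesis unfolding e using False by (simp add: geometric_sum_root)
    qed
  qed
  have "(\<Sum>j<n. A j * B j) = (\<Sum>j<n. \<Sum>r<n. \<Sum>s<n. of_nat r * of_nat s * ((w ^ j) ^ r * (v ^ j) ^ s))"
    unfolding A_def B_def sum_product by (simp add: mult_ac)
  also have "\<dots> = (\<Sum>r<n. \<Sum>s<n. \<Sum>j<n. of_nat r * of_nat s * ((w ^ j) ^ r * (v ^ j) ^ s))"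
    by (subst sum.swap, rule sum.cong [OF refl], subst sum.swap, rule refl)
  also have "\<dots> = (\<Sum>r<n. \<Sum>s<n. if r = s then of_nat r * of_nat s * of_nat n else 0)"
    by (intro sum.cong refl) (simp add: orth flip: sum_distrib_left)
  also have "\<dots> = of_nat n * (\<Sum>r<n. of_nat r ^ 2)"
    by (simp add: sum_distrib_left power2_eq_square mult_ac)
  finally have "6 * (\<Sum>j<n. A j * B j) = of_nat n ^ 2 * (of_nat n - 1) * (2 * of_nat n - 1)"
    using sum_squares[of n] by algebra
  moreover have "{..<n} = insert 0 {1..<n}" using \<open>n > 0\<close> by auto
  \<comment> \<open>Parseval counts j = 0 as well. That term is the square of 0 + 1 + ... + (n-1)
    and has to be subtracted.\<close>
  moreover have "4 * (A 0 * B 0) = (of_nat n * (of_nat n - 1)) ^ 2"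
    unfolding sum_naturals[symmetric] by (simp add: A_def B_def power2_eq_square)
  moreover have "12 * y = m ^ 2 * (2 * (m - 1) * (2 * m - 1) - 3 * (m - 1) ^ 2)"
    if "6 * (x + y) = m ^ 2 * (m - 1) * (2 * m - 1)" "4 * x = (m * (m - 1)) ^ 2" for x y m :: complex
    using that by algebra
  ultimately have "12 * (\<Sum>j\<in>{1..<n}. A j * B j) =
      of_nat n ^ 2 * (2 * (of_nat n - 1) * (2 * of_nat n - 1) - 3 * (of_nat n - 1) ^ 2)"
    by simp
  also have "(\<Sum>j\<in>{1..<n}. A j * B j) = - (of_nat n ^ 2) * (\<Sum>j\<in>{1..<n}. w ^ j / (1 - w ^ j) ^ 2)"
    unfolding sum_distrib_left by (rule sum.cong [OF refl AB])
  finally have "12 * (- (of_nat n ^ 2) * (\<Sum>j\<in>{1..<n}. w ^ j / (1 - w ^ j) ^ 2)) =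
      of_nat n ^ 2 * (2 * (of_nat n - 1) * (2 * of_nat n - 1) - 3 * (of_nat n - 1) ^ 2)" .
  moreover have "y = - (m ^ 2 - 1) / 12"
    if "12 * (- (m ^ 2) * y) = m ^ 2 * (2 * (m - 1) * (2 * m - 1) - 3 * (m - 1) ^ 2)" "m \<noteq> 0"
    for y m :: complex
  proof -
    have "m ^ 2 * (12 * y) = m ^ 2 * - (m ^ 2 - 1)" using that(1) by algebra
    then have "12 * y = - (m ^ 2 - 1)" using that(2) by (simp only: mult_cancel_left) simp
    then show ?thesis by (simp add: field_simps)
  qed
  ultimately show ?thesis
    using \<open>n > 0\<close> by simp
qed

text \<open>As n is odd, z^2 is again a primitive n-th root of unity. Since y/(1-y)^2 is invariant
  under y -> 1/y, the indices j and n-j contribute equally, and the sum is half of the full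
  one.\<close>

lemma sum_root_of_unity_half:
  fixes z :: complex
  assumes n: "n = 2 * N + 1" and z: "\<And>j. z ^ j = 1 \<longleftrightarrow> n dvd j"
  shows "(\<Sum>i<N. z ^ (2 * Suc i) / (1 - z ^ (2 * Suc i)) ^ 2) = - (of_nat n ^ 2 - 1) / 24"
proof -
  define w where "w = z ^ 2"
  have w: "w ^ j = 1 \<longleftrightarrow> n dvd j" for j
    using n by (simp add: w_def z coprime_dvd_mult_right_iff flip: power_mult)
  have "w \<noteq> 0" using w[of n] n by (auto simp: power_0_left)
  let ?f = "\<lambda>j. w ^ j / (1 - w ^ j) ^ 2"
  have sym: "?f (n - j) = ?f j" if "j \<in> {1..N}" for j
  proof -
    have j: "w ^ j \<noteq> 1" using that w[of j] n by (auto dest: dvd_imp_le)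
    have "w ^ (n - j) = inverse (w ^ j)"
      using that n w[of n] \<open>w \<noteq> 0\<close> by (simp add: power_diff inverse_eq_divide)
    moreover have "inverse y / (1 - inverse y) ^ 2 = y / (1 - y) ^ 2" if "y \<noteq> 0" "y \<noteq> 1" for y :: complex
    proof -
      have "1 - inverse y = - (1 - y) / y"
        using that by (simp add: field_simps)
      then have "(1 - inverse y) ^ 2 = (1 - y) ^ 2 / y ^ 2"
        by (simp add: power_divide power2_commute)
      then show ?thesis using that by (simp add: power2_eq_square)
    qed
    ultimately show ?thesis
      using \<open>w \<noteq> 0\<close> j by (metis power_not_zero)
  qed
  have "{1..<n} = {1..N} \<union> (\<lambda>j. n - j) ` {1..N}"
  proof -
    have "j \<in> (\<lambda>j. n - j) ` {1..N}" if "N < j" "j < n" for j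
      using that n by (intro image_eqI[of _ _ "n - j"]) auto
    then have "{1..<n} \<subseteq> {1..N} \<union> (\<lambda>j. n - j) ` {1..N}"
      by (meson UnI1 UnI2 atLeastAtMost_iff atLeastLessThan_iff not_le subsetI)
    moreover have "{1..N} \<union> (\<lambda>j. n - j) ` {1..N} \<subseteq> {1..<n}"
      using n by auto
    ultimately show ?thesis by (rule equalityI)
  qed
  moreover have "{1..N} \<inter> (\<lambda>j. n - j) ` {1..N} = {}" using n by auto
  ultimately have "sum ?f {1..<n} = sum ?f {1..N} + sum ?f ((\<lambda>j. n - j) ` {1..N})"
    by (simp add: sum.union_disjoint)
  also have "sum ?f ((\<lambda>j. n - j) ` {1..N}) = sum ?f {1..N}"
  proof -
    have "inj_on (\<lambda>j. n - j) {1..N}" using n by (auto simp: inj_on_def)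
    then have "sum ?f ((\<lambda>j. n - j) ` {1..N}) = (\<Sum>j\<in>{1..N}. ?f (n - j))"
      by (simp add: sum.reindex)
    also have "\<dots> = sum ?f {1..N}" by (rule sum.cong [OF refl sym])
    finally show ?thesis .
  qed
  also have "sum ?f {1..N} = (\<Sum>i<N. ?f (Suc i))"
    by (rule sum.reindex_bij_witness[of _ Suc "\<lambda>j. j - 1"]) auto
  also have "(\<Sum>i<N. ?f (Suc i)) = (\<Sum>i<N. z ^ (2 * Suc i) / (1 - z ^ (2 * Suc i)) ^ 2)"
    by (simp only: w_def power_mult [symmetric])
  finally have "- (of_nat n ^ 2 - 1) / 12 = 2 * (\<Sum>i<N. z ^ (2 * Suc i) / (1 - z ^ (2 * Suc i)) ^ 2)"
    using sum_root_of_unity_full[of n w] n w by simp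
  then show ?thesis by (simp only: eq_divide_eq divide_eq_eq) (simp add: field_simps)
qed

section \<open>Orders of vanishing at a root of unity of order d\<close>

lemma qR_power_neq_1:
  assumes "j > 0"
  shows "qR ^ j \<noteq> 1"
proof
  have "to_fract (qP ^ j) = qR ^ j" by (induction j) (simp_all add: qR_def)
  moreover assume "qR ^ j = 1"
  ultimately have "qP ^ j = 1" by (metis to_fract_1 to_fract_eq_iff)
  then have "degree (qP ^ j) = 0" by simp
  then show False using assms by (simp add: degree_power_eq qP_def)
qed

lemma qR_neq_0: "qR \<noteq> 0"
  by (simp add: qR_def qP_def)

lemma has_value_one_minus_qR_power: "has_value z (1 - qR ^ j) (1 - z ^ j)"
  by (intro has_value_intros)

lemma has_value_qshifted: "has_value z (qshifted (qR ^ a) (qR ^ b) m) (qshifted (z ^ a) (z ^ b) m)"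
  unfolding qshifted_def by (intro has_value_intros)

context
  fixes z :: complex and d :: nat
  assumes root: "\<And>j. z ^ j = 1 \<longleftrightarrow> d dvd j"
begin

text \<open>If g = d h, the cofactor is a geometric sum with value h at z, which is nonzero in
  characteristic zero. If d does not divide g, the factor itself is nonzero at z. The order of a
  product of such factors thus reduces to counting multiples of d.\<close>

lemma one_minus_qR_power_eq:
  assumes "g > 0"
  shows "\<exists>w c. 1 - qR ^ g = (1 - qR ^ d) ^ (if d dvd g then 1 else 0) * w \<and> has_value z w c \<and> c \<noteq> 0"
proof (cases "d dvd g")
  case True
  then obtain h where h: "g = d * h" ..
  have "1 - qR ^ g = (1 - qR ^ d) * (\<Sum>i<h. (qR ^ d) ^ i)"
    by (simp add: h power_mult one_diff_power_eq)
  moreover have "has_value z (\<Sum>i<h. (qR ^ d) ^ i) (\<Sum>i<h. (z ^ d) ^ i)"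
    by (intro has_value_intros)
  moreover have "(\<Sum>i<h. (z ^ d) ^ i) \<noteq> 0"
    using root[of d] assms h by simp
  ultimately show ?thesis using True by auto
next
  case False
  then show ?thesis
    using has_value_one_minus_qR_power[of z g] root[of g] by (intro exI[of _ "1 - qR ^ g"]) auto
qed

lemma prod_one_minus_qR_power_eq:
  fixes m :: nat
  assumes "\<And>l. l < m \<Longrightarrow> g l > 0"
  shows "\<exists>w c. (\<Prod>l<m. 1 - qR ^ g l) = (1 - qR ^ d) ^ card {l. l < m \<and> d dvd g l} * w \<and> has_value z w c \<and> c \<noteq> 0"
  using assms
proof (induction m)
  case 0
  then show ?case by (intro exI[of _ 1]) (simp add: has_value_1)
next
  case (Suc m)
  have "\<exists>w c. (\<Prod>l<m. 1 - qR ^ g l) = (1 - qR ^ d) ^ card {l. l < m \<and> d dvd g l} * w \<and>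
      has_value z w c \<and> c \<noteq> 0"
    by (rule Suc.IH) (simp add: Suc.prems)
  then obtain w c where wc: "(\<Prod>l<m. 1 - qR ^ g l) = (1 - qR ^ d) ^ card {l. l < m \<and> d dvd g l} * w"
    "has_value z w c" "c \<noteq> 0" by blast
  obtain w' c' where wc': "1 - qR ^ g m = (1 - qR ^ d) ^ (if d dvd g m then 1 else 0) * w'"
    "has_value z w' c'" "c' \<noteq> 0"
    using one_minus_qR_power_eq[of "g m"] Suc.prems by auto
  have "{l. l < Suc m \<and> d dvd g l} = (if d dvd g m then {m} else {}) \<union> {l. l < m \<and> d dvd g l}"
    by (auto simp: less_Suc_eq)
  then have "card {l. l < Suc m \<and> d dvd g l} = card {l. l < m \<and> d dvd g l} + (if d dvd g m then 1 else 0)"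
    by auto
  then show ?case
    using wc wc' by (intro exI[of _ "w * w'"] exI[of _ "c * c'"])
       (simp add: power_add has_value_mult mult_ac)
qed

lemma regular_prod_quotient:
  fixes m :: nat
  assumes f: "\<And>l. l < m \<Longrightarrow> f l > 0" and g: "\<And>l. l < m \<Longrightarrow> g l > 0"
    and card: "card {l. l < m \<and> d dvd f l} \<le> card {l. l < m \<and> d dvd g l}"
  shows "regular z ((\<Prod>l<m. 1 - qR ^ g l) / (\<Prod>l<m. 1 - qR ^ f l))"
proof -
  let ?\<delta> = "1 - qR ^ d"
  let ?F = "card {l. l < m \<and> d dvd f l}" and ?G = "card {l. l < m \<and> d dvd g l}"
  obtain w c where wc: "(\<Prod>l<m. 1 - qR ^ g l) = ?\<delta> ^ ?G * w" "has_value z w c"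
    using prod_one_minus_qR_power_eq[of m g] g by blast
  obtain w' c' where wc': "(\<Prod>l<m. 1 - qR ^ f l) = ?\<delta> ^ ?F * w'" "has_value z w' c'" "c' \<noteq> 0"
    using prod_one_minus_qR_power_eq[of m f] f by blast
  have "(\<Prod>l<m. 1 - qR ^ f l) \<noteq> 0" using f qR_power_neq_1 by fastforce
  then have "?\<delta> ^ ?F \<noteq> 0" using wc'(1) by auto
  moreover have "?\<delta> ^ ?G = ?\<delta> ^ ?F * ?\<delta> ^ (?G - ?F)"
    using card by (simp flip: power_add)
  ultimately have "(\<Prod>l<m. 1 - qR ^ g l) / (\<Prod>l<m. 1 - qR ^ f l) = ?\<delta> ^ (?G - ?F) * (w / w')"
    unfolding wc(1) wc'(1) by (simp only: mult.assoc mult_divide_mult_cancel_left_if) simp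
  moreover have "regular z (w / w')"
    using wc(2) wc'(2,3) unfolding regular_def by (blast intro: has_value_divide)
  ultimately show ?thesis
    by (simp only:) (intro regular_closed)
qed

text \<open>Among any \<open>m\<close> consecutive terms of an arithmetic progression with difference 2, the first
  multiple of \<open>d\<close> can only come later than for the progression starting at 0.\<close>

lemma regular_progression_quotient:
  fixes m :: nat
  assumes "b > 0" and g: "\<And>l. l < m \<Longrightarrow> g l > 0" "\<And>l. l < m \<Longrightarrow> d dvd 2 * l \<Longrightarrow> d dvd g l"
  shows "regular z ((\<Prod>l<m. 1 - qR ^ g l) / (\<Prod>l<m. 1 - qR ^ (b + 2 * l)))"
proof (rule regular_prod_quotient)
  let ?F = "{l. l < m \<and> d dvd b + 2 * l}" and ?G = "{l. l < m \<and> d dvd g l}"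
  show "card ?F \<le> card ?G"
  proof (cases "?F = {}")
    case False
    \<comment> \<open>Subtracting the first hit sends every hit l to an index with d | 2(l - l0),
      where \<open>g\<close> is a multiple of d by assumption.\<close>
    define l0 where "l0 = (LEAST l. l \<in> ?F)"
    have l0: "l0 \<in> ?F" using False unfolding l0_def by (metis LeastI ex_in_conv)
    have le: "l0 \<le> l" if "l \<in> ?F" for l using that unfolding l0_def by (rule Least_le)
    show ?thesis
    proof (rule card_inj_on_le)
      show "inj_on (\<lambda>l. l - l0) ?F"
        using le by (intro inj_onI) (metis le_add_diff_inverse2)
      show "(\<lambda>l. l - l0) ` ?F \<subseteq> ?G"
      proof clarify
        fix l assume l: "l < m" "d dvd b + 2 * l"
        then have "d dvd (b + 2 * l) - (b + 2 * l0)"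
          using l0 by (intro dvd_diff_nat) auto
        then have "d dvd 2 * (l - l0)" by (simp add: right_diff_distrib')
        then show "l - l0 < m \<and> d dvd g (l - l0)"
          using l g(2)[of "l - l0"] by auto
      qed
    qed simp
  qed (simp only: card.empty)
qed (use assms in auto)

lemma regular_one_minus_quotient:
  assumes "j > 0" "n > 0" "d dvd n"
  shows "regular z ((1 - qR ^ n) / (1 - qR ^ j))"
  using regular_progression_quotient[of j 1 "\<lambda>_. n"] assms by simp

text \<open>Meant for x = (1-q^n)^2 in the central product. Once (1-q^n)^3 is taken out, the
  remainder still vanishes at a primitive root of unity, and only the sum of the coefficients
  matters there.\<close>

lemma prod_one_minus_expand:
  fixes N :: nat
  assumes "\<And>i. i < N \<Longrightarrow> regular z (a i)" "regular z x"
  shows "\<exists>b. regular z b \<and> (\<Prod>i<N. 1 - x * a i) = 1 - x * (\<Sum>i<N. a i) + x ^ 2 * b"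
  using assms
proof (induction N)
  case 0
  then show ?case by (intro exI[of _ 0]) (simp add: regular_closed)
next
  case (Suc N)
  have "\<exists>b. regular z b \<and> (\<Prod>i<N. 1 - x * a i) = 1 - x * (\<Sum>i<N. a i) + x ^ 2 * b"
    by (rule Suc.IH) (simp_all add: Suc.prems)
  then obtain b where b: "regular z b" "(\<Prod>i<N. 1 - x * a i) = 1 - x * (\<Sum>i<N. a i) + x ^ 2 * b"
    by blast
  have "(\<Prod>i<Suc N. 1 - x * a i) = 1 - x * (\<Sum>i<Suc N. a i) +
      x ^ 2 * (a N * (\<Sum>i<N. a i) + b - x * a N * b)"
    by (simp add: b(2)) (simp add: algebra_simps power2_eq_square)
  moreover have "regular z (a N * (\<Sum>i<N. a i) + b - x * a N * b)"
    using Suc.prems b(1) by (intro regular_closed regular_sum) auto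
  ultimately show ?case by blast
qed

end

section \<open>Reflection of q-shifted factorials where z^n = 1\<close>

text \<open>The exponents 2(N-j) and 2j+1 add up to n, so z^(2j+1) (1 - z^(2(N-j))) = -(1 -
  z^(2j+1)). The top factors of the even product fold onto the bottom factors of the odd one, and
  the odd powers multiply to z^(j^2).\<close>

lemma reflect_even:
  fixes z :: "'a::comm_ring_1"
  assumes "z ^ (2 * N + 1) = 1" "j \<le> N"
  shows "z ^ (j ^ 2) * qshifted (z ^ 2) (z ^ 2) N = (-1) ^ j * qshifted (z ^ 2) (z ^ 2) (N - j) * qshifted z (z ^ 2) j"
  using assms(2)
proof (induction j)
  case (Suc j)
  define T where "T = qshifted (z ^ 2) (z ^ 2) (N - Suc j)"
  define u where "u = z ^ (2 * (N - j))"
  define v where "v = z ^ (2 * j + 1)"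
  have "2 * (N - j) + (2 * j + 1) = 2 * N + 1" using Suc.prems by simp
  then have uv: "u * v = 1" using assms(1) by (metis power_add u_def v_def)
  have "N - j = Suc (N - Suc j)" using Suc.prems by simp
  then have T: "qshifted (z ^ 2) (z ^ 2) (N - j) = T * (1 - u)"
    by (simp only: qshifted_Suc T_def u_def power_mult power_Suc)
  have O: "qshifted z (z ^ 2) (Suc j) = qshifted z (z ^ 2) j * (1 - v)"
    by (simp add: qshifted_Suc v_def power_mult)
  have "Suc j ^ 2 = j ^ 2 + (2 * j + 1)" by (simp add: power2_eq_square)
  then have "z ^ (Suc j ^ 2) * qshifted (z ^ 2) (z ^ 2) N = z ^ (j ^ 2) * qshifted (z ^ 2) (z ^ 2) N * v"
    by (simp only: power_add v_def mult_ac)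
  also have "z ^ (j ^ 2) * qshifted (z ^ 2) (z ^ 2) N = (-1) ^ j * (T * (1 - u)) * qshifted z (z ^ 2) j"
    using Suc T by simp
  also have "\<dots> * v = (-1) ^ j * T * qshifted z (z ^ 2) j * ((1 - u) * v)"
    by (simp only: mult_ac)
  also have "(1 - u) * v = - (1 - v)" using uv by (simp add: algebra_simps)
  also have "(-1) ^ j * T * qshifted z (z ^ 2) j * - (1 - v) = (-1) ^ Suc j * T * (qshifted z (z ^ 2) j * (1 - v))"
    by (simp add: algebra_simps)
  finally show ?case
    unfolding O T_def .
qed simp

text \<open>The mirror image: the top factors of the odd product fold onto the even ones, and the
  monomials with exponents 2, 4, ..., 2j multiply to z^(j^2+j).\<close>

lemma reflect_odd:
  fixes z :: "'a::comm_ring_1"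
  assumes "z ^ (2 * N + 1) = 1" "j \<le> N"
  shows "z ^ (j ^ 2 + j) * qshifted z (z ^ 2) N = (-1) ^ j * qshifted z (z ^ 2) (N - j) * qshifted (z ^ 2) (z ^ 2) j"
  using assms(2)
proof (induction j)
  case (Suc j)
  define T where "T = qshifted z (z ^ 2) (N - Suc j)"
  define u where "u = z ^ (2 * (N - Suc j) + 1)"
  define v where "v = z ^ (2 * Suc j)"
  have "2 * (N - Suc j) + 1 + 2 * Suc j = 2 * N + 1" using Suc.prems by simp
  then have uv: "u * v = 1" using assms(1) by (metis power_add u_def v_def)
  have "N - j = Suc (N - Suc j)" using Suc.prems by simp
  then have T: "qshifted z (z ^ 2) (N - j) = T * (1 - u)"
    by (simp add: qshifted_Suc T_def u_def power_mult)
  have O: "qshifted (z ^ 2) (z ^ 2) (Suc j) = qshifted (z ^ 2) (z ^ 2) j * (1 - v)"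
    by (simp only: qshifted_Suc v_def power_mult power_Suc)
  have "Suc j ^ 2 + Suc j = j ^ 2 + j + 2 * Suc j" by (simp add: power2_eq_square)
  then have "z ^ (Suc j ^ 2 + Suc j) * qshifted z (z ^ 2) N = z ^ (j ^ 2 + j) * qshifted z (z ^ 2) N * v"
    by (simp only: power_add v_def mult_ac)
  also have "z ^ (j ^ 2 + j) * qshifted z (z ^ 2) N = (-1) ^ j * (T * (1 - u)) * qshifted (z ^ 2) (z ^ 2) j"
    using Suc T by simp
  also have "\<dots> * v = (-1) ^ j * T * qshifted (z ^ 2) (z ^ 2) j * ((1 - u) * v)"
    by (simp only: mult_ac)
  also have "(1 - u) * v = - (1 - v)" using uv by (simp add: algebra_simps)
  also have "(-1) ^ j * T * qshifted (z ^ 2) (z ^ 2) j * - (1 - v) = (-1) ^ Suc j * T * (qshifted (z ^ 2) (z ^ 2) j * (1 - v))"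
    by (simp add: algebra_simps)
  finally show ?case
    unfolding O T_def .
qed simp

text \<open>With k = N-1-i, the even product is reflected at k+1 and the odd one at k. The two
  reflections share z^(k^2+k), and the leftover z^(k+1) is the power in the right-hand
  summand.\<close>

lemma reflect_term:
  fixes z :: complex
  assumes n: "n = 2 * N + 1" and z: "\<And>j. z ^ j = 1 \<longleftrightarrow> n dvd j" and "i < N"
  shows "(-1) ^ N * z ^ N ^ 2 * (z ^ (2 * Suc i) *
      (qshifted (z ^ 2) (z ^ 2) i / qshifted (z ^ 2) (z ^ 2) (Suc i)) *
      (qshifted (z ^ 2) (z ^ 2) i / qshifted z (z ^ 2) (Suc i))) =
    z ^ Suc (N - Suc i) * (qshifted (z ^ 2) (z ^ 2) (N - Suc i) /
      ((1 - z ^ (2 * (N - Suc i) + 1)) * qshifted z (z ^ 2) (Suc (N - Suc i))))"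
proof -
  let ?T = "qshifted (z ^ 2) (z ^ 2)" and ?O = "qshifted z (z ^ 2)"
  define k where "k = N - Suc i"
  define u where "u = z ^ (2 * Suc i)"
  define v where "v = z ^ (2 * k + 1)"
  have zn: "z ^ (2 * N + 1) = 1" using z[of n] n by (metis dvd_refl)
  have "z \<noteq> 0" using zn by (auto simp: power_0_left)
  have T: "?T m \<noteq> 0" if "m \<le> N" for m
  proof -
    have "z ^ (2 * Suc l) \<noteq> 1" if "l < m" for l
      using z[of "2 * Suc l"] n that \<open>m \<le> N\<close> by (auto dest!: dvd_imp_le)
    moreover have "z ^ (2 * Suc l) = z ^ 2 * (z ^ 2) ^ l" for l
      by (simp only: power_mult power_Suc)
    ultimately show ?thesis by (simp add: qshifted_def)
  qed
  have O: "?O m \<noteq> 0" if "m \<le> N" for m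
  proof -
    have "z ^ (2 * l + 1) \<noteq> 1" if "l < m" for l
      using z[of "2 * l + 1"] n that \<open>m \<le> N\<close> by (auto dest!: dvd_imp_le)
    then show ?thesis by (auto simp: qshifted_def power_mult)
  qed
  have "2 * Suc i + (2 * k + 1) = 2 * N + 1" using \<open>i < N\<close> by (simp add: k_def)
  then have uv: "u * v = 1" using zn by (metis power_add u_def v_def)
  have "u \<noteq> 1" using z[of "2 * Suc i"] n \<open>i < N\<close> by (auto simp: u_def dest!: dvd_imp_le)
  have "v \<noteq> 1" using uv \<open>u \<noteq> 1\<close> by auto
  have "N - Suc k = i" "N - k = Suc i" "k < N" using \<open>i < N\<close> by (auto simp: k_def)
  then have 1: "z ^ (Suc k ^ 2) * ?T N = (-1) ^ Suc k * ?T i * ?O (Suc k)"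
    and 2: "z ^ (k ^ 2 + k) * ?O N = (-1) ^ k * ?O (Suc i) * ?T k"
    using reflect_even[OF zn, of "Suc k"] reflect_odd[OF zn, of k] by simp_all
  \<comment> \<open>The extreme case j = N evaluates the prefactor: as z^(2N^2+N) = 1, (-1)^N
    z^(N^2) is the quotient of the full odd product by the full even one.\<close>
  have "z ^ (N ^ 2 + N) * ?O N = (-1) ^ N * ?T N"
    using reflect_odd[OF zn, of N] by simp
  then have "z ^ (N ^ 2) * z ^ (N ^ 2 + N) * ?O N = (-1) ^ N * z ^ (N ^ 2) * ?T N"
    by (simp only: mult.assoc mult.left_commute)
  moreover have "z ^ (N ^ 2) * z ^ (N ^ 2 + N) = 1"
  proof -
    have "N ^ 2 + (N ^ 2 + N) = (2 * N + 1) * N" by (simp add: power2_eq_square)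
    then show ?thesis using zn by (metis power_add power_mult power_one)
  qed
  ultimately have c: "(-1) ^ N * z ^ (N ^ 2) = ?O N / ?T N"
    using T[of N] by (simp only: mult_1_left) simp
  have Ti: "?T (Suc i) = ?T i * (1 - u)"
    by (simp only: qshifted_Suc u_def power_mult power_Suc)
  have "Suc k ^ 2 = Suc k + (k ^ 2 + k)" by (simp add: power2_eq_square)
  then have 3: "z ^ (Suc k ^ 2) = z ^ Suc k * z ^ (k ^ 2 + k)" by (simp only: power_add)
  have sg: "(-1 :: complex) ^ k * (-1) ^ k = 1" by (simp flip: power_mult_distrib)
  have "?O N * (?T i * ?O (Suc k)) = - ((-1) ^ k * (-1) ^ k) * ?O N * (?T i * ?O (Suc k)) * - 1"
    by (simp only: sg) simp
  also have "\<dots> = - ((-1) ^ k) * ?O N * (z ^ Suc k * z ^ (k ^ 2 + k) * ?T N)"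
    using 1 unfolding 3 by (simp add: mult_ac)
  also have "\<dots> = - (z ^ Suc k * ?T N * ((-1) ^ k * (-1) ^ k * ?O (Suc i) * ?T k))"
    using 2 by (simp add: mult_ac)
  finally have main: "?O N * (?T i * ?O (Suc k)) = - (z ^ Suc k * ?T N * (?O (Suc i) * ?T k))"
    by (simp only: sg) simp
  \<comment> \<open>This trades the factor 1-u from \<open>?T (Suc i)\<close> for the factor 1-v of
    the right-hand denominator; its sign cancels the one in \<open>main\<close>.\<close>
  have "u * (1 - v) = - (1 - u)" using uv by (simp add: algebra_simps)
  then have "(u * (1 - v)) * (?O N * (?T i * ?O (Suc k))) = (1 - u) * (z ^ Suc k * ?T N * (?O (Suc i) * ?T k))"
    by (simp only: main minus_mult_minus)
  then have main': "?O N * u * ?T i * ((1 - v) * ?O (Suc k)) = z ^ Suc k * ?T k * (?T N * ((1 - u) * ?O (Suc i)))"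
    by (simp only: mult_ac)
  have "(-1) ^ N * z ^ (N ^ 2) * (u * (?T i / ?T (Suc i)) * (?T i / ?O (Suc i)))
      = ?O N * u * ?T i / (?T N * ((1 - u) * ?O (Suc i)))"
    unfolding c Ti using T[of i] \<open>i < N\<close> by simp
  also have "\<dots> = z ^ Suc k * ?T k / ((1 - v) * ?O (Suc k))"
    using main' T[of N] O[of "Suc i"] O[of "Suc k"] \<open>u \<noteq> 1\<close> \<open>v \<noteq> 1\<close> \<open>i < N\<close> \<open>k < N\<close>
    by (intro iffD2 [OF frac_eq_eq]) auto
  finally show ?thesis
    by (simp only: u_def v_def k_def times_divide_eq_right)
qed

lemma reflect_sum:
  fixes z :: complex
  assumes n: "n = 2 * N + 1" and z: "\<And>j. z ^ j = 1 \<longleftrightarrow> n dvd j"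
  shows "(-1) ^ N * z ^ N ^ 2 * (\<Sum>i<N. z ^ (2 * Suc i) *
      (qshifted (z ^ 2) (z ^ 2) i / qshifted (z ^ 2) (z ^ 2) (Suc i)) *
      (qshifted (z ^ 2) (z ^ 2) i / qshifted z (z ^ 2) (Suc i))) =
    (\<Sum>k<N. z ^ Suc k * (qshifted (z ^ 2) (z ^ 2) k /
      ((1 - z ^ (2 * k + 1)) * qshifted z (z ^ 2) (Suc k))))"
  unfolding sum_distrib_left
  by (subst sum.nat_diff_reindex [symmetric], rule sum.cong [OF refl])
     (rule reflect_term [OF n z], simp)

section \<open>The congruence at roots of unity\<close>

definition cubic_sum :: "nat \<Rightarrow> int poly fract" where
  "cubic_sum n = (\<Sum>i<n. (-1) ^ i * (1 - qR ^ (3 * i + 1)) *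
     (qshifted qR (qR ^ 2) i ^ 3 / qshifted qR qR i ^ 3))"

text \<open>The sum on the right of the congruence divided by (1-q)^2, with its index lowered by
  one; the last factor of (q^2;q^2)_(k+1) is cancelled against [2k+2].\<close>

definition correction_sum :: "nat \<Rightarrow> int poly fract" where
  "correction_sum N = (\<Sum>k<N. qR ^ Suc k * (qshifted (qR ^ 2) (qR ^ 2) k /
      ((1 - qR ^ (2 * k + 1)) * qshifted qR (qR ^ 2) (Suc k))))"

text \<open>The two main terms times 1-q. In the first, q^((1-n^2)/4) and the power n choose 2 are
  merged into q^(N^2). The second keeps the exponent -(N^2+N), which gives the same value at n-th
  roots of unity because 2N^2+N = nN.\<close>

definition cubic_main :: "nat \<Rightarrow> int poly fract" where
  "cubic_main N = (-1) ^ N * (qR ^ N ^ 2 * (1 - qR ^ (2 * N + 1)) +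
     of_int (int (2 * N + 1) ^ 2 - 1) / 24 * inverse (qR ^ (N ^ 2 + N)) * (1 - qR ^ (2 * N + 1)) ^ 3)"

lemma qshifted_square_qR: "qshifted (qR ^ 2) (qR ^ 2) m = (\<Prod>l<m. 1 - qR ^ (2 + 2 * l))"
  by (simp only: qshifted_def power_add power_mult)

lemma qshifted_odd_qR: "qshifted qR (qR ^ 2) m = (\<Prod>l<m. 1 - qR ^ (1 + 2 * l))"
  by (simp add: qshifted_def power_add power_mult)

lemma
  fixes z :: complex
  assumes root: "\<And>j. z ^ j = 1 \<longleftrightarrow> d dvd j" and "d > 0"
  shows z_nonzero: "z \<noteq> 0"
    and regular_inverse_qR_power: "regular z (inverse (qR ^ j))"
    and regular_fraction_24: "regular z (of_int a / 24)"
proof -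
  show nz: "z \<noteq> 0" using root[of d] \<open>d > 0\<close> by (auto simp: power_0_left)
  have "has_value z (inverse (qR ^ j)) (inverse (z ^ j))"
    by (intro has_value_intros) (simp add: nz)
  then show "regular z (inverse (qR ^ j))" by (auto simp: regular_def)
  have "has_value z (of_int a / 24) (of_int a / 24)"
    by (intro has_value_intros) simp
  then show "regular z (of_int a / 24)" by (auto simp: regular_def)
qed

lemma vanishes_one_minus_qR_power: "z ^ j = 1 \<Longrightarrow> vanishes z 1 (1 - qR ^ j)"
  using has_value_one_minus_qR_power[of z j] by (intro vanishes_1) simp

text \<open>With one factor e taken out, the cofactor has to be regular. Its denominators can vanish
  at z, but the double pole of each \<open>?a i\<close> and the poles of
  \<open>correction_sum N\<close> are absorbed by the remaining e^2, while the quotients in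
  \<open>?Q\<close> are regular by counting multiples of d.\<close>

lemma cubic_congruence_divisor:
  assumes root: "\<And>j. z ^ j = 1 \<longleftrightarrow> d dvd j" and n: "n = 2 * N + 1" and "d dvd n"
  shows "vanishes z 1 (cubic_sum n - (cubic_main N + (1 - qR ^ n) ^ 3 * correction_sum N))"
proof -
  let ?e = "1 - qR ^ n"
  let ?T = "qshifted (qR ^ 2) (qR ^ 2)" and ?O = "qshifted qR (qR ^ 2)"
  let ?D = "\<lambda>m. \<Prod>l<m. 1 - qR ^ (n + 2 * l)"
  let ?a = "\<lambda>i. qR ^ (2 * Suc i) / (qR ^ n * (1 - qR ^ (2 * Suc i)) ^ 2)"
  have "d > 0" using \<open>d dvd n\<close> n by (auto intro: Nat.gr0I)
  note inv = regular_inverse_qR_power[OF root \<open>d > 0\<close>] regular_fraction_24[OF root \<open>d > 0\<close>]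
  note quot = regular_one_minus_quotient[OF root _ _ \<open>d dvd n\<close>]
  have e: "regular z ?e" by (intro regular_closed)
  have a: "regular z (?e ^ 2 * ?a i)" for i
  proof -
    have "?e ^ 2 * ?a i = (?e / (1 - qR ^ (2 * Suc i))) ^ 2 * (qR ^ (2 * Suc i) * inverse (qR ^ n))"
      by (simp only: power_divide times_divide_eq_right times_divide_eq_left divide_inverse inverse_mult_distrib power_mult_distrib power_inverse mult_ac)
    moreover have "regular z (?e / (1 - qR ^ (2 * Suc i)))"
      by (rule quot) (use n in auto)
    ultimately show ?thesis
      by (simp only:) (intro regular_closed inv)
  qed
  have npos: "0 < n" using n by simp
  have D: "regular z (?D m / ?T m)" "regular z (?D m / ?O m)" for m
    unfolding qshifted_square_qR qshifted_odd_qR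
    by (rule regular_progression_quotient[OF root]; simp add: npos dvd_add \<open>d dvd n\<close>)+
  have R: "regular z (?e ^ 2 * correction_sum N)"
    unfolding correction_sum_def sum_distrib_left
  proof (rule regular_sum)
    fix k
    \<comment> \<open>One of the two factors e serves the denominator 1-q^(2k+1). The other becomes
      factor 0 of the numerator, since (q^2;q^2)_k has one factor fewer than (q;q^2)_(k+1).\<close>
    define g where "g l = (if l = 0 then n else 2 * l)" for l
    have "?e * ?T k = (\<Prod>l<Suc k. 1 - qR ^ g l)"
      unfolding qshifted_square_qR by (simp only: prod.lessThan_Suc_shift) (simp add: g_def)
    moreover have "regular z ((\<Prod>l<Suc k. 1 - qR ^ g l) / ?O (Suc k))"
      unfolding qshifted_odd_qR
      by (rule regular_progression_quotient[OF root]) (use \<open>d dvd n\<close> n in \<open>auto simp: g_def\<close>)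
    ultimately have "regular z (?e * ?T k / ?O (Suc k))" by simp
    moreover have "regular z (?e / (1 - qR ^ (2 * k + 1)))"
      by (rule quot) (use n in auto)
    moreover have "?e ^ 2 * (qR ^ Suc k * (?T k / ((1 - qR ^ (2 * k + 1)) * ?O (Suc k)))) =
      qR ^ Suc k * (?e / (1 - qR ^ (2 * k + 1))) * (?e * ?T k / ?O (Suc k))"
      by (simp add: power2_eq_square)
    ultimately show "regular z (?e ^ 2 * (qR ^ Suc k * (?T k / ((1 - qR ^ (2 * k + 1)) * ?O (Suc k)))))"
      by (simp only:) (intro regular_closed)
  qed
  let ?P = "(-1) ^ N * qR ^ N ^ 2 * (\<Prod>i<N. 1 - ?e ^ 2 * ?a i)"
  let ?Q = "\<Sum>m\<le>N. qR ^ (2 * m) * (?D m / ?T m) * (?D m / ?O m)"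
  have "cubic_sum n = ?e * ?P * ?Q"
    unfolding cubic_sum_def by (rule cubic_sum_factored [OF qR_power_neq_1 qR_neq_0 n])
  moreover have "cubic_main N = ?e * ((-1) ^ N * (qR ^ N ^ 2 +
     of_int (int (2 * N + 1) ^ 2 - 1) / 24 * inverse (qR ^ (N ^ 2 + N)) * ?e ^ 2))"
    unfolding cubic_main_def n by (simp only: power3_eq_cube power2_eq_square) (simp only: algebra_simps)
  ultimately have "cubic_sum n - (cubic_main N + ?e ^ 3 * correction_sum N) = ?e * (?P * ?Q -
      ((-1) ^ N * (qR ^ N ^ 2 +
     of_int (int (2 * N + 1) ^ 2 - 1) / 24 * inverse (qR ^ (N ^ 2 + N)) * ?e ^ 2) + ?e ^ 2 * correction_sum N))"
    by (simp only: power3_eq_cube power2_eq_square) (simp only: algebra_simps)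
  moreover have "regular z (?P * ?Q -
      ((-1) ^ N * (qR ^ N ^ 2 +
     of_int (int (2 * N + 1) ^ 2 - 1) / 24 * inverse (qR ^ (N ^ 2 + N)) * ?e ^ 2) + ?e ^ 2 * correction_sum N))"
    by (intro regular_closed regular_sum regular_prod inv a D R e)
  moreover have "vanishes z 1 ?e"
    using root[of n] \<open>d dvd n\<close> by (intro vanishes_one_minus_qR_power) simp
  ultimately show ?thesis
    using vanishes_mult[of z 1 ?e 0] by (simp only: vanishes_0_iff) simp
qed

text \<open>Once e^3 is pulled out, a single zero of the cofactor at z remains to be shown. It comes
  from two equalities of values: the root-of-unity sum against (n^2-1)/24, and the reflected terms
  against the correction sum.\<close>

lemma cubic_congruence_primitive:
  assumes root: "\<And>j. z ^ j = 1 \<longleftrightarrow> n dvd j" and n: "n = 2 * N + 1"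
  shows "vanishes z 4 (cubic_sum n - (cubic_main N + (1 - qR ^ n) ^ 3 * correction_sum N))"
proof -
  let ?e = "1 - qR ^ n"
  let ?T = "qshifted (qR ^ 2) (qR ^ 2)" and ?O = "qshifted qR (qR ^ 2)"
  let ?t = "qshifted (z ^ 2) (z ^ 2)" and ?o = "qshifted z (z ^ 2)"
  let ?D = "\<lambda>m. \<Prod>l<m. 1 - qR ^ (n + 2 * l)"
  let ?E = "\<lambda>m. \<Prod>l<m. 1 - qR ^ (n + 2 * Suc l)"
  let ?a = "\<lambda>i. qR ^ (2 * Suc i) / (qR ^ n * (1 - qR ^ (2 * Suc i)) ^ 2)"
  let ?c = "(of_nat n ^ 2 - 1) / 24 :: complex"
  have "n > 0" using n by simp
  have z0: "z \<noteq> 0" and zn: "z ^ n = 1"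
    using z_nonzero[OF root \<open>n > 0\<close>] root[of n] by simp_all
  have ne: "z ^ j \<noteq> 1" if "j > 0" "j < n" for j
    using root[of j] that by (auto dest: dvd_imp_le)
  have even_ne: "z ^ (2 * Suc i) \<noteq> 1" if "i < N" for i
    using that n by (intro ne) auto
  have odd_ne: "z ^ (2 * i + 1) \<noteq> 1" if "i < N" for i
    using that n by (intro ne) auto
  have t: "?t m = (\<Prod>l<m. 1 - z ^ (2 * Suc l))" for m
  proof -
    have "z ^ (2 * Suc l) = z ^ 2 * (z ^ 2) ^ l" for l
      by (simp only: power_mult power_Suc)
    then show ?thesis by (simp only: qshifted_def)
  qed
  have t0: "?t m \<noteq> 0" if "m \<le> N" for m
    using that even_ne by (simp add: t)
  have o0: "?o m \<noteq> 0" if "m \<le> N" for m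
    using that odd_ne by (auto simp: qshifted_def power_mult)
  have T: "has_value z (?T m) (?t m)" for m
    using has_value_qshifted[of z 2 2 m] .
  have O: "has_value z (?O m) (?o m)" for m
    using has_value_qshifted[of z 1 2 m] by simp
  \<comment> \<open>\<open>?E i\<close> is \<open>?D (Suc i)\<close> without its factor e, so each
    term of \<open>?Q\<close> with m > 0 carries e^2. Since z^n = 1, the exponents n+2l act as
    2l.\<close>
  have E: "has_value z (?E m) (?t m)" for m
  proof -
    have "has_value z (?E m) (\<Prod>l<m. 1 - z ^ (n + 2 * Suc l))"
      by (intro has_value_intros)
    then show ?thesis by (simp only: power_add zn mult_1_left t)
  qed
  have e: "has_value z ?e 0"
    using has_value_one_minus_qR_power[of z n] zn by simp
  have a: "has_value z (?a i) (z ^ (2 * Suc i) / (1 - z ^ (2 * Suc i)) ^ 2)" if "i < N" for i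
  proof -
    have "has_value z (?a i) (z ^ (2 * Suc i) / (z ^ n * (1 - z ^ (2 * Suc i)) ^ 2))"
      using even_ne[OF that] z0 by (intro has_value_intros) (simp only: mult_eq_0_iff power_eq_0_iff, simp)
    then show ?thesis by (simp only: zn mult_1_left)
  qed
  have sum_a: "has_value z (\<Sum>i<N. ?a i) (- ?c)"
  proof -
    have "has_value z (\<Sum>i<N. ?a i) (\<Sum>i<N. z ^ (2 * Suc i) / (1 - z ^ (2 * Suc i)) ^ 2)"
      by (intro has_value_sum a) simp
    then show ?thesis by (simp only: sum_root_of_unity_half[OF n root] minus_divide_left)
  qed
  have "\<exists>b. regular z b \<and> (\<Prod>i<N. 1 - ?e ^ 2 * ?a i) = 1 - ?e ^ 2 * (\<Sum>i<N. ?a i) + (?e ^ 2) ^ 2 * b"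
  proof (rule prod_one_minus_expand [OF root])
    show "regular z (?a i)" if "i < N" for i
      using a[OF that] by (auto simp: regular_def)
    show "regular z (?e ^ 2)" by (intro regular_closed)
  qed
  then obtain b where "regular z b"
    and prod: "(\<Prod>i<N. 1 - ?e ^ 2 * ?a i) = 1 - ?e ^ 2 * (\<Sum>i<N. ?a i) + (?e ^ 2) ^ 2 * b"
    by blast
  then obtain \<beta> where b: "has_value z b \<beta>" by (auto simp: regular_def)
  define Z where "Z = (\<Prod>i<N. 1 - ?e ^ 2 * ?a i)"
  have Z: "has_value z Z 1"
  proof -
    have "has_value z Z (1 - 0 ^ 2 * (- ?c) + (0 ^ 2) ^ 2 * \<beta>)"
      unfolding Z_def prod by (intro has_value_intros e sum_a b)
    then show ?thesis by simp
  qed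
  define W where "W = (\<Sum>i<N. qR ^ (2 * Suc i) * (?E i / ?T (Suc i)) * (?E i / ?O (Suc i)))"
  define w where "w = (\<Sum>i<N. z ^ (2 * Suc i) * (?t i / ?t (Suc i)) * (?t i / ?o (Suc i)))"
  have W: "has_value z W w"
    unfolding W_def w_def
    by (intro has_value_intros E T O t0 o0) auto
  have R: "has_value z (correction_sum N) ((-1) ^ N * z ^ N ^ 2 * w)"
    unfolding correction_sum_def w_def reflect_sum[OF n root]
  proof (intro has_value_intros T O)
    fix k assume "k \<in> {..<N}"
    then show "(1 - z ^ (2 * k + 1)) * ?o (Suc k) \<noteq> 0"
      using odd_ne[of k] o0[of "Suc k"] by auto
  qed
  let ?Q = "\<Sum>m\<le>N. qR ^ (2 * m) * (?D m / ?T m) * (?D m / ?O m)"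
  have Q: "?Q = 1 + ?e ^ 2 * W"
  proof -
    have D: "?D (Suc i) = ?e * ?E i" for i
      by (simp only: prod.lessThan_Suc_shift) simp
    have "?Q = 1 + (\<Sum>i<N. qR ^ (2 * Suc i) * (?D (Suc i) / ?T (Suc i)) * (?D (Suc i) / ?O (Suc i)))"
      by (simp only: lessThan_Suc_atMost [symmetric] sum.lessThan_Suc_shift) simp
    also have "(\<Sum>i<N. qR ^ (2 * Suc i) * (?D (Suc i) / ?T (Suc i)) * (?D (Suc i) / ?O (Suc i))) = ?e ^ 2 * W"
      unfolding W_def sum_distrib_left D
      by (rule sum.cong [OF refl]) (simp only: power2_eq_square times_divide_eq_right times_divide_eq_left mult_ac)
    finally show ?thesis .
  qed
  let ?h = "of_int (int (2 * N + 1) ^ 2 - 1) / 24 * inverse (qR ^ (N ^ 2 + N))"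
  \<comment> \<open>The first group compares the e^3 parts of the central term and of
    \<open>cubic_main N\<close>, the second the terms with m > 0 and the correction sum. Each group
    vanishes at z.\<close>
  define Y where "Y = (-1) ^ N * (qR ^ N ^ 2 * (- (\<Sum>i<N. ?a i) + ?e ^ 2 * b) - ?h) +
      ((-1) ^ N * qR ^ N ^ 2 * Z * W - correction_sum N)"
  have "cubic_sum n = ?e * ((-1) ^ N * qR ^ N ^ 2 * Z) * (1 + ?e ^ 2 * W)"
    unfolding cubic_sum_def Q [symmetric] Z_def by (rule cubic_sum_factored [OF qR_power_neq_1 qR_neq_0 n])
  moreover have "\<dots> = ?e * ((-1) ^ N * qR ^ N ^ 2) * Z + ?e ^ 3 * ((-1) ^ N * qR ^ N ^ 2 * Z * W)"
    by (simp add: power3_eq_cube power2_eq_square distrib_left mult_ac)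
  moreover have "?e * ((-1) ^ N * qR ^ N ^ 2) * Z = (-1) ^ N * qR ^ N ^ 2 * ?e +
      ?e ^ 3 * ((-1) ^ N * (qR ^ N ^ 2 * (- (\<Sum>i<N. ?a i) + ?e ^ 2 * b)))"
    unfolding Z_def prod by (simp only: power3_eq_cube power2_eq_square) (simp only: algebra_simps)
  moreover have "cubic_main N = (-1) ^ N * qR ^ N ^ 2 * ?e + ?e ^ 3 * ((-1) ^ N * ?h)"
    unfolding cubic_main_def n by (simp only: distrib_left mult_ac)
  ultimately have "cubic_sum n - (cubic_main N + ?e ^ 3 * correction_sum N) = ?e ^ 3 * Y"
    unfolding Y_def by (simp only: right_diff_distrib distrib_left)
  moreover have "has_value z Y 0"
  proof -
    have "has_value z Y ((-1) ^ N * (z ^ N ^ 2 * (- (- ?c) + 0 ^ 2 * \<beta>) -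
        of_int (int (2 * N + 1) ^ 2 - 1) / 24 * inverse (z ^ (N ^ 2 + N))) +
        ((-1) ^ N * z ^ N ^ 2 * 1 * w - (-1) ^ N * z ^ N ^ 2 * w))"
      unfolding Y_def by (intro has_value_intros e b sum_a W R Z) (use z0 in auto)
    moreover have "inverse (z ^ (N ^ 2 + N)) = z ^ N ^ 2"
    proof -
      have "N ^ 2 + N + N ^ 2 = n * N" using n by (simp add: power2_eq_square)
      then have "z ^ (N ^ 2 + N) * z ^ N ^ 2 = 1" using zn by (metis power_add power_mult power_one)
      then show ?thesis by (rule inverse_unique)
    qed
    moreover have "of_int (int (2 * N + 1) ^ 2 - 1) / 24 = ?c"
      using n by simp
    ultimately show ?thesis by simp
  qed
  moreover have "vanishes z 3 (?e ^ 3)"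
    using zn by (intro vanishes_power vanishes_one_minus_qR_power)
  ultimately show ?thesis
    using vanishes_mult[of z 3 "?e ^ 3" 1 Y] vanishes_1[of z Y] by simp
qed

section \<open>Orders of roots of unity and normal forms of both sides\<close>

lemma cis_eq_1_iff_dvd:
  assumes "n > 0"
  shows "cis (2 * pi * real j / real n) = 1 \<longleftrightarrow> n dvd j"
proof
  assume "cis (2 * pi * real j / real n) = 1"
  then have "cos (2 * pi * real j / real n) = 1" by (simp add: complex_eq_iff)
  then obtain m :: int where "2 * pi * real j / real n = of_int m * 2 * pi"
    unfolding cos_one_2pi_int by blast
  then have "real j = m * real n" using assms by (simp add: field_simps)
  then have "int j = m * int n" by (metis of_int_eq_iff of_int_mult of_int_of_nat_eq)
  then show "n dvd j" by (metis dvd_triv_right int_dvd_int_iff)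
next
  assume "n dvd j"
  then obtain m where "j = n * m" ..
  then show "cis (2 * pi * real j / real n) = 1"
    using assms cis_multiple_2pi[of "real m"] by (simp add: mult.assoc)
qed

text \<open>Supplies the hypothesis \<open>root\<close> of the local results, with d = n / gcd(k,
  n).\<close>

lemma cis_power_eq_1_iff_dvd:
  assumes "n > 0"
  shows "cis (2 * pi * real k / real n) ^ j = 1 \<longleftrightarrow> n div gcd k n dvd j"
proof -
  have "cis (2 * pi * real k / real n) ^ j = cis (2 * pi * real (k * j) / real n)"
    by (simp add: Complex.DeMoivre mult_ac)
  then have "cis (2 * pi * real k / real n) ^ j = 1 \<longleftrightarrow> n dvd k * j"
    by (simp only: cis_eq_1_iff_dvd[OF assms])
  also have "\<dots> \<longleftrightarrow> n div gcd k n dvd j"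
  proof -
    define g where "g = gcd k n"
    obtain k' n' where kn: "k = g * k'" "n = g * n'" by (metis dvdE g_def gcd_dvd1 gcd_dvd2)
    have "g > 0" using assms by (simp add: g_def)
    have "coprime k' n'"
      using div_gcd_coprime[of k n] assms kn \<open>g > 0\<close> by (metis g_def less_numeral_extra(3) nonzero_mult_div_cancel_left)
    then have "n dvd k * j \<longleftrightarrow> n' dvd j"
      using \<open>g > 0\<close> by (simp add: kn mult.assoc coprime_dvd_mult_right_iff coprime_commute)
    then show ?thesis using kn(2) \<open>g > 0\<close> unfolding g_def [symmetric] by simp
  qed
  finally show ?thesis .
qed

lemma qint_qR: "qint qR m = (1 - qR ^ m) / (1 - qR)"
  using qint_times[of qR m] qR_power_neq_1[of 1] by (simp add: field_simps)

lemma left_side_eq: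
  assumes "n > 0"
  shows "(\<Sum>k = 0..n - 1. (-1) ^ k * qint qR (3 * k + 1) *
        (qshifted qR (qR ^ 2) k ^ 3 / qshifted qR qR k ^ 3)) = cubic_sum n / (1 - qR)"
proof -
  have "{0..n - 1} = {..<n}" using assms by auto
  then show ?thesis
    unfolding cubic_sum_def qint_qR sum_divide_distrib by (simp add: mult.commute)
qed

lemma inner_sum_eq:
  "(\<Sum>k = 1..N. qR ^ k * qshifted (qR ^ 2) (qR ^ 2) k /
      (qint qR (2 * k) * qint qR (2 * k - 1) * qshifted qR (qR ^ 2) k)) = (1 - qR) ^ 2 * correction_sum N"
proof -
  let ?T = "qshifted (qR ^ 2) (qR ^ 2)" and ?O = "qshifted qR (qR ^ 2)"
  let ?f = "\<lambda>k. qR ^ k * ?T k / (qint qR (2 * k) * qint qR (2 * k - 1) * ?O k)"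
  have "?f (Suc k) = (1 - qR) ^ 2 * (qR ^ Suc k * (?T k / ((1 - qR ^ (2 * k + 1)) * ?O (Suc k))))" for k
  proof -
    have "1 - qR ^ (2 * Suc k) \<noteq> 0" using qR_power_neq_1[of "2 * Suc k"] by simp
    moreover have "1 - qR \<noteq> 0" using qR_power_neq_1[of 1] by simp
    moreover have "?T (Suc k) = ?T k * (1 - qR ^ (2 * Suc k))"
      by (simp only: qshifted_Suc power_mult power_Suc)
    moreover have "2 * Suc k - 1 = 2 * k + 1" by simp
    moreover have "x * (t * w) / (w / p * (v / p) * y) = p ^ 2 * (x * (t / (v * y)))"
      if "w \<noteq> 0" "p \<noteq> 0" for x t w p v y :: "int poly fract"
      using that by (simp add: power2_eq_square)
    ultimately show ?thesis by (simp only: qint_qR)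
  qed
  moreover have "sum ?f {1..N} = (\<Sum>k<N. ?f (Suc k))"
    by (rule sum.reindex_bij_witness[of _ Suc "\<lambda>j. j - 1"]) auto
  ultimately show ?thesis
    by (simp only: correction_sum_def sum_distrib_left)
qed

lemma right_side_eq:
  assumes n: "n = 2 * N + 1"
  shows "(-1) ^ ((n - 1) div 2) * qR powi ((1 - int n ^ 2) div 4) *
        (qR ^ (n choose 2) * qint qR n
          + of_int (int n ^ 2 - 1) * (1 - qR) ^ 2 / 24 * qint qR n ^ 3)
      + qint qR n ^ 3 *
        (\<Sum>k = 1..(n - 1) div 2. qR ^ k * qshifted (qR ^ 2) (qR ^ 2) k /
            (qint qR (2 * k) * qint qR (2 * k - 1) * qshifted qR (qR ^ 2) k))
    = (cubic_main N + (1 - qR ^ n) ^ 3 * correction_sum N) / (1 - qR)"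
proof -
  define p where "p = 1 - qR"
  define e where "e = 1 - qR ^ n"
  define R where "R = correction_sum N"
  define h where "h = inverse (qR ^ (N ^ 2 + N))"
  define c :: "int poly fract" where "c = of_int (int n ^ 2 - 1)"
  have "p \<noteq> 0" using qR_power_neq_1[of 1] by (simp add: p_def)
  have N: "(n - 1) div 2 = N" using n by simp
  have q: "qint qR n = e / p" by (simp add: qint_qR p_def e_def)
  \<comment> \<open>The integer division by 4 is exact. Together with the exponent n choose 2 =
    2N^2+N it leaves q^(N^2) in the first main term.\<close>
  have "1 - int n ^ 2 = 4 * (- int (N ^ 2 + N))" using n by (simp add: power2_eq_square algebra_simps)
  then have "(1 - int n ^ 2) div 4 = - int (N ^ 2 + N)" by simp
  then have h: "qR powi ((1 - int n ^ 2) div 4) = h" by (simp only: h_def power_int_minus power_int_of_nat)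
  have "n choose 2 = N ^ 2 + N + N ^ 2" using n by (simp add: choose_two power2_eq_square algebra_simps)
  then have hC: "h * qR ^ (n choose 2) = qR ^ N ^ 2"
    using qR_neq_0 by (simp only: h_def power_add [of qR "N ^ 2 + N"]) simp
  have m: "cubic_main N = (-1) ^ N * (qR ^ N ^ 2 * e + c / 24 * h * e ^ 3)"
    by (simp only: cubic_main_def n c_def h_def e_def)
  have "(-1) ^ N * h * (qR ^ (n choose 2) * (e / p) + c * p ^ 2 / 24 * (e / p) ^ 3) + (e / p) ^ 3 * (p ^ 2 * R)
     = (-1) ^ N * ((h * qR ^ (n choose 2)) * (e / p) + c / 24 * h * (p ^ 2 * (e / p) ^ 3)) + p ^ 2 * (e / p) ^ 3 * R"
    by (simp only: distrib_left times_divide_eq_left times_divide_eq_right mult_ac)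
  also have "p ^ 2 * (e / p) ^ 3 = e ^ 3 / p"
    using \<open>p \<noteq> 0\<close> by (simp add: power2_eq_square power3_eq_cube)
  finally show ?thesis
    unfolding N q h inner_sum_eq hC m p_def [symmetric] e_def [symmetric] R_def [symmetric] c_def [symmetric]
    by (simp add: add_divide_distrib distrib_left)
qed

theorem theorem1p2:
  fixes n :: nat
  assumes "n > 0" and "odd n"
  shows "rat_cong
    (\<Sum>k = 0..n - 1. (-1) ^ k * qint qR (3 * k + 1) *
        (qshifted qR (qR ^ 2) k ^ 3 / qshifted qR qR k ^ 3))
    ((-1) ^ ((n - 1) div 2) * qR powi ((1 - int n ^ 2) div 4) *
        (qR ^ (n choose 2) * qint qR n
          + of_int (int n ^ 2 - 1) * (1 - qR) ^ 2 / 24 * qint qR n ^ 3)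
      + qint qR n ^ 3 *
        (\<Sum>k = 1..(n - 1) div 2. qR ^ k * qshifted (qR ^ 2) (qR ^ 2) k /
            (qint qR (2 * k) * qint qR (2 * k - 1) * qshifted qR (qR ^ 2) k)))
    (qint qP n * cyclotomic n ^ 3)"
proof -
  obtain N where n: "n = 2 * N + 1" using \<open>odd n\<close> by (elim oddE)
  show ?thesis
    unfolding left_side_eq[OF \<open>n > 0\<close>] right_side_eq[OF n]
  proof (cases "n = 1")
    \<comment> \<open>For n = 1 the modulus is the cube of Phi_1, whose root q = 1 is not among the
      points of the local test. Here the two sides coincide and the difference is 0.\<close>
    case True
    then have "cubic_sum n = cubic_main N + (1 - qR ^ n) ^ 3 * correction_sum N"
      using n by (simp add: cubic_sum_def cubic_main_def correction_sum_def)
    then show "rat_cong (cubic_sum n / (1 - qR))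
        ((cubic_main N + (1 - qR ^ n) ^ 3 * correction_sum N) / (1 - qR)) (qint qP n * cyclotomic n ^ 3)"
      by (simp add: rat_cong_def)
  next
    case False
    let ?x = "cubic_sum n - (cubic_main N + (1 - qR ^ n) ^ 3 * correction_sum N)"
    show "rat_cong (cubic_sum n / (1 - qR))
        ((cubic_main N + (1 - qR ^ n) ^ 3 * correction_sum N) / (1 - qR)) (qint qP n * cyclotomic n ^ 3)"
    proof (rule rat_congI)
      fix k assume k: "1 \<le> k" "k < n"
      define z where "z = cis (2 * pi * real k / real n)"
      have root: "z ^ j = 1 \<longleftrightarrow> n div gcd k n dvd j" for j
        unfolding z_def by (rule cis_power_eq_1_iff_dvd[OF \<open>n > 0\<close>])
      \<comment> \<open>The point 1 is excluded, so the common factor 1/(1-q) of both sides is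
        regular at z and costs no order of vanishing.\<close>
      have "z \<noteq> 1"
        using cis_eq_1_iff_dvd[OF \<open>n > 0\<close>, of k] k by (auto simp: z_def dest: dvd_imp_le)
      then have "has_value z (inverse (1 - qR)) (inverse (1 - z))"
        by (intro has_value_intros) simp
      then have inv: "vanishes z 0 (inverse (1 - qR))"
        by (auto simp: vanishes_0_iff regular_def)
      have "vanishes z (if coprime k n then 4 else 1) ?x"
      proof (cases "coprime k n")
        case True
        then show ?thesis
          using cubic_congruence_primitive[of z n N] root n by simp
      next
        case False
        have "n div gcd k n dvd n" by (metis dvd_triv_left dvd_mult_div_cancel gcd_dvd2 mult.commute)
        then show ?thesis
          using cubic_congruence_divisor[OF root n] False by simp
      qed
      then have "vanishes z (if coprime k n then 4 else 1) (?x * inverse (1 - qR))"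
        using vanishes_mult[OF _ inv] by fastforce
      then show "vanishes (cis (2 * pi * real k / real n)) (if coprime k n then 4 else 1)
          (cubic_sum n / (1 - qR) - (cubic_main N + (1 - qR ^ n) ^ 3 * correction_sum N) / (1 - qR))"
        by (simp only: z_def divide_inverse left_diff_distrib)
    qed (use False \<open>n > 0\<close> in simp)
  qed
qed

end
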